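(* Let $d\ge2$, let $a$ be a bounded divergence-free vector field on $\mathbb{R}^d$ and let $u\in\mathcal{C}_w([0,T);L^\infty)$ be the corresponding mild solution of the Navier--Stokes system (NS). Assume that there exists a function $m$ on $\mathbb{R}^d$ such that $$|e^{t\Delta}a(x)|\le C_t\,(1+|x|)^{-\vartheta}\,m(x)^{-1},$$ with $\frac{d+1}{2}<\vartheta\le d+1$ and $1\le m(x)\le C\,(1+|x|)^{d+1-\vartheta}$. Then, for all $T'<T$, there exists a constant $C_{T'}$ (which might also depend on the data) such that $$|u(x,t)|\le C_{T'}\,(1+|x|)^{-\vartheta}\,m(x)^{-1}$$ for all $t\in[0,T']$.
   Context: (NS) is the system on $\mathbb{R}^d$: $\partial_t u-\Delta u+(u\cdot\nabla)u=-\nabla p$, $\operatorname{div}u=0$, $u(x,0)=a(x)$, understood in the mild sense $u(t)=e^{t\Delta}a-\int_0^te^{(t-s)\Delta}\mathbb{P}\operatorname{div}(u\otimes u)(s)\,ds$ with $\mathbb{P}f=f-\nabla\Delta^{-1}(\operatorname{div}f)$ and $e^{t\Delta}a(x)=(4\pi t)^{-d/2}\int_{\mathbb{R}^d}e^{-|x-y|^2/4t}a(y)\,dy$ ($e^{0\Delta}a=a$). $\mathcal{C}_w([0,T);L^\infty)$ is the space of $u(x,t)$ with $u(t)\in L^\infty$ for all $t\in[0,T)$, continuous in $t>0$ for the $L^\infty$ norm, with $u(t)\to u(0)$ in the distributional sense as $t\to0$; its elements are understood to be bounded in $L^\infty$ on each $[0,T']$, $T'<T$. It is known that for bounded divergence-free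 $a$ the mild solution in this class is unique, and that if $a$ satisfies $\operatorname{ess\,sup}_x(1+|x|)^{\vartheta}|a(x)|<\infty$, then $u$ has the same decay, with exponent $\min\{\vartheta;d+1\}$, uniformly on each $[0,T']$. The hypothesis on $e^{t\Delta}a$ is for all $t\in[0,T)$ and $x\in\mathbb{R}^d$, with $t\mapsto C_t$ a locally bounded function on $[0,T)$. *)

theory Defs
  imports "HOL-Analysis.Analysis" "HOL-Probability.Essential_Supremum"
begin

section \<open>Differential operators\<close>

definition partial_deriv :: "'n::finite \<Rightarrow> (real^'n \<Rightarrow> real) \<Rightarrow> real^'n \<Rightarrow> real" where
  "partial_deriv i f x = deriv (\<lambda>s. f (x + s *\<^sub>R axis i 1)) 0"

definition grad :: "(real^'n::finite \<Rightarrow> real) \<Rightarrow> real^'n \<Rightarrow> real^'n" where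
  "grad f x = (\<chi> i. partial_deriv i f x)"

definition divergence :: "(real^'n::finite \<Rightarrow> real^'n) \<Rightarrow> real^'n \<Rightarrow> real" where
  "divergence f x = (\<Sum>i\<in>UNIV. partial_deriv i (\<lambda>y. f y $ i) x)"

definition laplacian :: "(real^'n::finite \<Rightarrow> real) \<Rightarrow> real^'n \<Rightarrow> real" where
  "laplacian f x = (\<Sum>i\<in>UNIV. partial_deriv i (partial_deriv i f) x)"

definition C2 :: "(real^'n::finite \<Rightarrow> real) \<Rightarrow> bool" where
  "C2 f \<longleftrightarrow>
     (\<forall>x. f differentiable (at x)) \<and>
     (\<forall>i x. partial_deriv i f differentiable (at x)) \<and>
     (\<forall>i j. continuous_on UNIV (partial_deriv i (partial_deriv j f)))"

definition test_function :: "(real^'n::finite \<Rightarrow> real) \<Rightarrow> bool" where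
  "test_function \<phi> \<longleftrightarrow>
     compact (closure {x. \<phi> x \<noteq> 0}) \<and>
     (\<forall>is x. foldr partial_deriv is \<phi> differentiable (at x))"

section \<open>The space \<open>L\<^sup>\<infinity>\<close>\<close>

text \<open>Elements of \<open>L\<^sup>\<infinity>\<close> are represented by measurable functions, so that pointwise
  statements about them hold almost everywhere.\<close>

definition Linf_norm :: "(real^'n::finite \<Rightarrow> real^'n) \<Rightarrow> ereal" where
  "Linf_norm f = esssup lebesgue (\<lambda>x. ereal (norm (f x)))"

definition Linf :: "(real^'n::finite \<Rightarrow> real^'n) set" where
  "Linf = {f. f \<in> borel_measurable lebesgue \<and> Linf_norm f < \<infinity>}"

definition divergence_free :: "(real^'n::finite \<Rightarrow> real^'n) \<Rightarrow> bool" where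
  "divergence_free a \<longleftrightarrow>
     (\<forall>\<phi>. test_function \<phi> \<longrightarrow> (\<integral>x. a x \<bullet> grad \<phi> x \<partial>lebesgue) = 0)"

text \<open>The time horizon is an extended real, so that global solutions (\<open>T = \<infinity>\<close>) are included.\<close>

definition Cw :: "ereal \<Rightarrow> (real \<Rightarrow> real^'n::finite \<Rightarrow> real^'n) set" where
  "Cw T = {u.
     (\<forall>t\<ge>0. ereal t < T \<longrightarrow> u t \<in> Linf) \<and>
     (\<forall>t>0. ereal t < T \<longrightarrow> ((\<lambda>s. Linf_norm (\<lambda>x. u s x - u t x)) \<longlongrightarrow> 0) (at t)) \<and>
     (\<forall>\<phi>. test_function \<phi> \<longrightarrow>
        ((\<lambda>t. \<integral>x. \<phi> x *\<^sub>R u t x \<partial>lebesgue) \<longlongrightarrow> (\<integral>x. \<phi> x *\<^sub>R u 0 x \<partial>lebesgue)) (at_right 0)) \<and>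
     (\<forall>T'. ereal T' < T \<longrightarrow> (\<exists>B::real. \<forall>t\<in>{0..T'}. Linf_norm (u t) \<le> ereal B))}"

section \<open>The heat semigroup and the Leray projector\<close>

definition heat_kernel :: "real \<Rightarrow> real^'n::finite \<Rightarrow> real" where
  "heat_kernel t x =
     (4 * pi * t) powr (- real CARD('n) / 2) * exp (- (norm x)\<^sup>2 / (4 * t))"

definition heat :: "real \<Rightarrow> (real^'n::finite \<Rightarrow> real^'n) \<Rightarrow> real^'n \<Rightarrow> real^'n" where
  "heat t a x = (if t = 0 then a x else (\<integral>y. heat_kernel t (x - y) *\<^sub>R a y \<partial>lebesgue))"

text \<open>\<open>\<Delta>\<^sup>-\<^sup>1\<close> is the inverse of the Laplacian on functions that vanish at infinity, where
  the Laplacian is injective by the maximum principle. It is only applied to second derivatives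
  of the heat kernel, for which a solution exists in every dimension \<open>d \<ge> 2\<close>.\<close>

definition inv_laplacian :: "(real^'n::finite \<Rightarrow> real) \<Rightarrow> real^'n \<Rightarrow> real" where
  "inv_laplacian g = (THE w. C2 w \<and> (w \<longlongrightarrow> 0) at_infinity \<and> (\<forall>x. laplacian w x = g x))"

definition leray :: "(real^'n::finite \<Rightarrow> real^'n) \<Rightarrow> real^'n \<Rightarrow> real^'n" where
  "leray f x = f x - grad (inv_laplacian (divergence f)) x"

text \<open>For a matrix field \<open>M\<close> that is merely bounded, \<open>\<P> div M\<close> has no pointwise meaning, but
  \<open>e\<^bsup>t\<Delta>\<^esup> \<P> div\<close> is a convolution operator with an integrable kernel: with
  \<open>(div M)\<^sub>k = \<Sum>\<^sub>h \<partial>\<^sub>h M\<^sub>h\<^sub>k\<close>, all operators commute with convolutions, so that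
  \<open>e\<^bsup>t\<Delta>\<^esup> \<P> div M = \<Sum>\<^sub>h\<^sub>k \<P>(\<partial>\<^sub>h G\<^sub>t e\<^sub>k) * M\<^sub>h\<^sub>k\<close>, where \<open>G\<^sub>t\<close> is the heat kernel and
  \<open>e\<^sub>k\<close> the \<open>k\<close>-th basis vector.\<close>

definition oseen_kernel :: "real \<Rightarrow> 'n::finite \<Rightarrow> 'n \<Rightarrow> real^'n \<Rightarrow> real^'n" where
  "oseen_kernel t h k = leray (\<lambda>z. axis k (partial_deriv h (heat_kernel t) z))"

definition heat_leray_div :: "real \<Rightarrow> (real^'n::finite \<Rightarrow> real^'n^'n) \<Rightarrow> real^'n \<Rightarrow> real^'n" where
  "heat_leray_div t M x =
     (\<Sum>h\<in>UNIV. \<Sum>k\<in>UNIV. \<integral>y. (M y $ h $ k) *\<^sub>R oseen_kernel t h k (x - y) \<partial>lebesgue)"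

section \<open>Mild solutions\<close>

definition tensor :: "real^'n::finite \<Rightarrow> real^'n \<Rightarrow> real^'n^'n" where
  "tensor v w = (\<chi> h k. v $ h * w $ k)"

definition mild_solution ::
    "ereal \<Rightarrow> (real^'n::finite \<Rightarrow> real^'n) \<Rightarrow> (real \<Rightarrow> real^'n \<Rightarrow> real^'n) \<Rightarrow> bool" where
  "mild_solution T a u \<longleftrightarrow>
     (\<forall>t\<ge>0. ereal t < T \<longrightarrow>
        (AE x in lebesgue.
           u t x = heat t a x -
             (LINT s:{0..t}|lebesgue. heat_leray_div (t - s) (\<lambda>y. tensor (u s y) (u s y)) x)))"

end

theory Submission
  imports Defs
begin

text \<open>
  Since \<open>-\<Delta>\<^sup>-\<^sup>1 = \<integral>\<^sub>0\<^sup>\<infinity> e\<^bsup>s\<Delta>\<^esup> ds\<close>, the Oseen kernel is an explicit combination of the functions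
  \<open>\<integral>\<^sub>t\<^sup>\<infinity> s\<^bsup>-q-2\<^esup> exp (-\<bar>x\<bar>\<^sup>2 / 4s) ds\<close>, which yields \<open>\<bar>F(x, t)\<bar> \<le> A (\<surd>t + \<bar>x\<bar>)\<^bsup>-d-1\<^esup>\<close>. Convolution
  with such a kernel preserves every decay rate \<open>(1 + \<bar>x\<bar>)\<^bsup>-\<alpha>\<^esup>\<close>, \<open>0 \<le> \<alpha> \<le> d + 1\<close>, at the cost of an
  integrable factor \<open>t\<^bsup>-1/2\<^esup>\<close>. As \<open>\<bar>u\<bar>\<^sup>2 \<le> B \<bar>u\<bar>\<close>, the Duhamel term acts on \<open>\<bar>u\<bar>\<close> as a linear operator,
  and it halves bounds of the form \<open>e\<^bsup>\<mu>t\<^esup> (p (1 + \<bar>x\<bar>)\<^bsup>-\<theta>\<^esup> + q)\<close> once \<open>\<mu>\<close> is large; iterating from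
  \<open>p = 0\<close>, \<open>q = B\<close> shows that \<open>u\<close> decays like \<open>(1 + \<bar>x\<bar>)\<^bsup>-\<theta>\<^esup>\<close>. Because \<open>2\<theta> > d + 1\<close>, \<open>\<bar>u\<bar>\<^sup>2\<close> then decays
  at rate \<open>d + 1\<close>, hence so does the Duhamel term, and \<open>m\<close> grows at most like \<open>(1 + \<bar>x\<bar>)\<^bsup>d+1-\<theta>\<^esup>\<close>.
\<close>

section \<open>Moments of the heat kernel in time\<close>

text \<open>The substitution \<open>v = 1 / s\<close> turns \<open>\<integral>\<^sub>t\<^sup>\<infinity> s\<^bsup>-q-2\<^esup> exp (- r / 4s) ds\<close> into an integral over a compact
  interval.\<close>

definition heat_moment :: "real \<Rightarrow> real \<Rightarrow> real \<Rightarrow> real" where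
  "heat_moment t q r = integral {0..1/t} (\<lambda>v. v powr q * exp (- r * v / 4))"

lemma continuous_on_powr_nonneg:
  assumes "q > (0::real)" shows "continuous_on {0..} (\<lambda>v::real. v powr q)"
  using assms by (intro continuous_on_powr' continuous_intros) auto

lemma heat_moment_integrable:
  assumes "q \<ge> 0" "t > 0"
  shows "(\<lambda>v::real. v powr q * exp (- r * v / 4)) integrable_on {0..1/t}"
proof (cases "q = 0")
  case True \<comment> \<open>\<open>0 powr 0 = 0\<close>, so the integrand jumps at \<open>0\<close>\<close>
  have "(\<lambda>v::real. exp (- r * v / 4)) integrable_on {0..1/t}"
    by (intro integrable_continuous_real continuous_intros) simp
  then show ?thesis
    by (rule integrable_spike_finite[of "{0}", rotated 2]) (auto simp: True)
next
  case False
  with assms have "q > 0" by simp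
  then show ?thesis
    by (intro integrable_continuous_real continuous_on_mult continuous_intros
        continuous_on_subset[OF continuous_on_powr_nonneg]) auto
qed

text \<open>Differentiation under the integral brings down \<open>- v / 4\<close> and so raises the
  exponent by one: the moments form a family closed under differentiation. The new exponent is
  positive, hence the differentiated integrand is continuous up to \<open>v = 0\<close> even for
  \<open>q = 0\<close>.\<close>

lemma heat_moment_deriv:
  assumes "q \<ge> 0" "t > 0"
  shows "(heat_moment t q has_real_derivative - heat_moment t (q + 1) r / 4) (at r)"
proof -
  have "((\<lambda>r. integral (cbox 0 (1/t)) (\<lambda>v. v powr q * exp (- r * v / 4)))
      has_field_derivative integral (cbox 0 (1/t)) (\<lambda>v. - (v powr (q + 1) * exp (- r * v / 4)) / 4)) (at r within UNIV)"
  proof (rule leibniz_rule_field_derivative)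
    fix x v :: real
    assume "v \<in> cbox 0 (1/t)"
    then have v: "v \<ge> 0" by simp
    have e: "v powr q * v = v powr (q + 1)"
      using v by (cases "v = 0") (simp_all add: powr_add)
    show "((\<lambda>r. v powr q * exp (- r * v / 4)) has_field_derivative - (v powr (q + 1) * exp (- x * v / 4)) / 4) (at x within UNIV)"
      by (auto intro!: derivative_eq_intros simp: e[symmetric])
  next
    fix x
    show "(\<lambda>v. v powr q * exp (- x * v / 4)) integrable_on cbox 0 (1/t)"
      using heat_moment_integrable[OF assms, of x] by simp
  next
    have "continuous_on (UNIV \<times> {0..1/t}) (\<lambda>z::real\<times>real. snd z powr (q + 1))"
      using assms by (intro continuous_on_powr' continuous_intros) auto
    then show "continuous_on (UNIV \<times> cbox 0 (1/t)) (\<lambda>(x, v). - (v powr (q + 1) * exp (- x * v / 4)) / 4)"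
      unfolding case_prod_unfold cbox_interval
      by (intro continuous_on_minus continuous_on_divide continuous_on_mult
          continuous_on_exp continuous_on_const continuous_on_fst continuous_on_snd continuous_on_id) simp_all
  qed auto
  then show ?thesis
    unfolding heat_moment_def[abs_def] by simp
qed

text \<open>The derivative of \<open>v powr (q + 1) * exp (- r * v / 4)\<close> is integrated over
  \<open>{0..1/t}\<close>. The boundary term at \<open>1/t\<close> is the heat kernel up to a
  constant and a power of t; this is how the kernel reappears in the Laplacian of the
  potential.\<close>

lemma heat_moment_rec:
  assumes "q \<ge> 0" "t > 0"
  shows "r / 4 * heat_moment t (q + 1) r = (q + 1) * heat_moment t q r - t powr (- (q + 1)) * exp (- r / (4 * t))"
proof -
  have i: "((\<lambda>v. (q + 1) * (v powr q * exp (- r * v / 4)) - r / 4 * (v powr (q + 1) * exp (- r * v / 4)))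
     has_integral ((1/t) powr (q + 1) * exp (- r * (1/t) / 4) - 0 powr (q + 1) * exp (- r * 0 / 4))) {0..1/t}"
  proof (rule fundamental_theorem_of_calculus_interior)
    show "continuous_on {0..1/t} (\<lambda>v. v powr (q + 1) * exp (- r * v / 4))"
      using assms by (intro continuous_on_mult continuous_intros
        continuous_on_subset[OF continuous_on_powr_nonneg]) auto
    show "((\<lambda>v. v powr (q + 1) * exp (- r * v / 4)) has_vector_derivative
         (q + 1) * (v powr q * exp (- r * v / 4)) - r / 4 * (v powr (q + 1) * exp (- r * v / 4))) (at v)"
      if "v \<in> {0<..<1/t}" for v
      using that unfolding has_real_derivative_iff_has_vector_derivative[symmetric]
      by (auto intro!: derivative_eq_intros simp: algebra_simps)
  qed (use assms in auto)
  have "((\<lambda>v. (q + 1) * (v powr q * exp (- r * v / 4)) - r / 4 * (v powr (q + 1) * exp (- r * v / 4)))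
     has_integral ((q + 1) * heat_moment t q r - r / 4 * heat_moment t (q + 1) r)) {0..1/t}"
    unfolding heat_moment_def using assms
    by (intro has_integral_diff has_integral_mult_right integrable_integral heat_moment_integrable) auto
  from has_integral_unique[OF this i]
  have "(q + 1) * heat_moment t q r - r / 4 * heat_moment t (q + 1) r = (1/t) powr (q + 1) * exp (- r * (1/t) / 4)"
    using assms by simp
  also have "(1/t) powr (q + 1) = t powr (- (q + 1))"
    using assms by (simp only: powr_minus_divide powr_divide powr_one_eq_one)
  also have "- r * (1/t) / 4 = - r / (4 * t)" by simp
  finally show ?thesis by linarith
qed

lemma heat_moment_nonneg: "0 \<le> heat_moment t q r"
\<comment> \<open>For arbitrary q and t the integrand may fail to be integrable; the integral then
  has the default value 0.\<close>
proof (cases "(\<lambda>v. v powr q * exp (- r * v / 4)) integrable_on {0..1/t}")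
  case True
  then show ?thesis unfolding heat_moment_def by (intro integral_nonneg) auto
qed (simp add: heat_moment_def not_integrable_integral)

text \<open>The inequality \<open>y \<le> exp y\<close> at \<open>y = z / (q + 1)\<close> is raised
  to the power q. Dividing by \<open>q + 1\<close> instead of q covers \<open>q = 0\<close> as
  well.\<close>

lemma powr_exp_le:
  fixes q z :: real assumes "q \<ge> 0" "z \<ge> 0"
  shows "z powr q * exp (- z) \<le> (q + 1) powr q"
proof -
  have "z / (q + 1) \<le> exp (z / (q + 1))"
    using exp_ge_add_one_self[of "z / (q + 1)"] by linarith
  then have "(z / (q + 1)) powr q \<le> exp (z / (q + 1)) powr q"
    using assms by (intro powr_mono2) auto
  also have "\<dots> = exp (q * (z / (q + 1)))"
    by (simp add: powr_def)
  also have "\<dots> \<le> exp z"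
    using assms by (simp add: field_simps)
  finally have "z powr q \<le> (q + 1) powr q * exp z"
    using assms by (simp add: powr_divide field_simps)
  then show ?thesis
    by (simp add: exp_minus field_simps)
qed

lemma heat_moment_le_time:
  assumes "q \<ge> 0" "t > 0" "r \<ge> 0"
  shows "heat_moment t q r \<le> t powr (- (q + 1))"
proof -
  have "heat_moment t q r \<le> integral {0..1/t} (\<lambda>v. t powr (-q))"
    unfolding heat_moment_def
  proof (intro integral_le heat_moment_integrable assms)
    fix v assume v: "v \<in> {0..1/t}"
    have "v powr q * exp (- r * v / 4) \<le> (1/t) powr q * 1"
      using assms v by (intro mult_mono powr_mono2) (auto simp: mult_nonneg_nonneg)
    then show "v powr q * exp (- r * v / 4) \<le> t powr (-q)"
      using assms by (simp add: powr_divide powr_minus inverse_eq_divide)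
  qed auto
  also have "\<dots> = t powr (- q) * t powr (- 1)"
    using assms by (simp add: powr_minus_divide)
  also have "\<dots> = t powr (- (q + 1))"
    unfolding powr_add[symmetric] by simp
  finally show ?thesis .
qed

text \<open>One half of the exponential absorbs \<open>v powr q\<close>; the other half has integral
  at most \<open>8 / r\<close>, uniformly in t.\<close>

lemma heat_moment_le_space:
  assumes "q \<ge> 0" "t > 0" "r > 0"
  shows "heat_moment t q r \<le> (8 * (q + 1)) powr (q + 1) * r powr (- (q + 1))"
proof -
  have fi: "((\<lambda>v. exp (- r * v / 8)) has_integral (- 8 / r * exp (- r * (1/t) / 8) - - 8 / r * exp (- r * 0 / 8))) {0..1/t}"
    using assms
    by (intro fundamental_theorem_of_calculus)
      (auto simp: has_real_derivative_iff_has_vector_derivative[symmetric] intro!: derivative_eq_intros)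
  have "heat_moment t q r \<le> integral {0..1/t} (\<lambda>v. (8 * (q + 1)) powr q * r powr (- q) * exp (- r * v / 8))"
    unfolding heat_moment_def
  proof (intro integral_le heat_moment_integrable assms)
    show "(\<lambda>v. (8 * (q + 1)) powr q * r powr (- q) * exp (- r * v / 8)) integrable_on {0..1/t}"
      by (intro integrable_continuous_real continuous_intros) simp
    fix v assume v: "v \<in> {0..1/t}"
    have "(r * v / 8) powr q * exp (- (r * v / 8)) \<le> (q + 1) powr q"
      using assms v by (intro powr_exp_le) auto
    then have "(r * v / 8) powr q * exp (- (r * v / 8)) * exp (- (r * v / 8)) \<le> (q + 1) powr q * exp (- (r * v / 8))"
      by (intro mult_right_mono) auto
    moreover have "exp (- (r * v / 8)) * exp (- (r * v / 8)) = exp (- r * v / 4)"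
      by (simp add: mult_exp_exp)
    ultimately have "(r * v / 8) powr q * exp (- r * v / 4) \<le> (q + 1) powr q * exp (- r * v / 8)"
      by (simp add: mult.assoc)
    moreover have "(8 * (q + 1)) powr q = 8 powr q * (q + 1) powr q"
      by (rule powr_mult)
    ultimately show "v powr q * exp (- r * v / 4) \<le> (8 * (q + 1)) powr q * r powr (- q) * exp (- r * v / 8)"
      using assms v by (simp add: powr_mult powr_divide powr_minus field_simps)
  qed
  also have "\<dots> = (8 * (q + 1)) powr q * r powr (- q) * (8 / r - 8 / r * exp (- r * (1/t) / 8))"
    using integral_unique[OF fi] by simp
  also have "\<dots> \<le> (8 * (q + 1)) powr q * r powr (- q) * (8 / r)"
    using assms by (intro mult_left_mono) auto
  \<comment> \<open>The factor 8 is enlarged to \<open>8 * (q + 1)\<close> so that the constants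
    merge into a single power.\<close>
  also have "\<dots> \<le> (8 * (q + 1)) powr q * r powr (- q) * (8 * (q + 1) / r)"
    using assms by (intro mult_left_mono divide_right_mono) auto
  also have "\<dots> = (8 * (q + 1)) powr (q + 1) * r powr (- (q + 1))"
    using assms by (simp add: powr_add powr_minus powr_diff field_simps)
  finally show ?thesis .
qed

text \<open>The better of the two previous bounds is a power of
  \<open>M = max t (s\<^sup>2)\<close>, and \<open>(sqrt t + s)\<^sup>2 \<le> 4 * M\<close> turns
  the constant 8 into 32.\<close>

lemma heat_moment_bound:
  assumes "q \<ge> 0" "t > 0" "s \<ge> 0"
  shows "heat_moment t q (s\<^sup>2) \<le> (32 * (q + 1)) powr (q + 1) * (sqrt t + s) powr (- 2 * (q + 1))"
proof -
  define M where "M = max t (s\<^sup>2)"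
  have M: "M > 0" using assms by (auto simp: M_def)
  have c1: "1 \<le> (8 * (q + 1)) powr (q + 1)"
    using assms by (intro ge_one_powr_ge_zero) auto
  have "heat_moment t q (s\<^sup>2) \<le> (8 * (q + 1)) powr (q + 1) * M powr (- (q + 1))"
  proof (cases "t \<ge> s\<^sup>2")
    case True
    then have "M = t" by (simp add: M_def)
    then show ?thesis
      using heat_moment_le_time[OF assms(1,2), of "s\<^sup>2"]
        mult_right_mono[OF c1, of "t powr (- (q + 1))"] by simp
  next
    case False
    then have "M = s\<^sup>2" by (simp add: M_def)
    then show ?thesis
      using heat_moment_le_space[OF assms(1,2), of "s\<^sup>2"] M by simp
  qed
  also have "M powr (- (q + 1)) = 4 powr (q + 1) * (4 * M) powr (- (q + 1))"
    using M unfolding powr_minus_divide by (simp add: powr_mult)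
  also have "(4 * M) powr (- (q + 1)) \<le> ((sqrt t + s)\<^sup>2) powr (- (q + 1))"
  proof (rule powr_mono2')
    have sM: "sqrt t \<le> sqrt M" "s \<le> sqrt M"
      using assms by (auto simp: M_def real_le_rsqrt)
    have "sqrt t + s \<le> 2 * sqrt M" using add_mono[OF sM] by simp
    then have "(sqrt t + s)\<^sup>2 \<le> (2 * sqrt M)\<^sup>2"
      using assms by (intro power_mono) auto
    then show "(sqrt t + s)\<^sup>2 \<le> 4 * M" using M by (simp add: power2_eq_square)
    have "sqrt t + s > 0" using assms by (simp add: add_pos_nonneg)
    then show "0 < (sqrt t + s)\<^sup>2" by simp
  qed (use assms in auto)
  also have "((sqrt t + s)\<^sup>2) powr (- (q + 1)) = (sqrt t + s) powr (- 2 * (q + 1))"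
  proof -
    have "sqrt t + s > 0" using assms by (simp add: add_pos_nonneg)
    then have "(sqrt t + s)\<^sup>2 = (sqrt t + s) powr 2" by simp
    then show ?thesis by (simp add: powr_powr)
  qed
  finally show ?thesis
    using assms by (simp add: powr_mult[symmetric] mult.assoc[symmetric] )
qed

section \<open>Inverting the Laplacian\<close>

lemma partial_deriv_eq:
  assumes "(f has_derivative f') (at x)"
  shows "partial_deriv i f x = f' (axis i 1)"
proof -
  have "((\<lambda>s. x + s *\<^sub>R axis i 1) has_derivative (\<lambda>s. s *\<^sub>R axis i 1)) (at (0::real))"
    by (auto intro!: derivative_eq_intros)
  from has_derivative_compose[OF this, of f f'] assms
  have "((\<lambda>s. f (x + s *\<^sub>R axis i 1)) has_derivative (\<lambda>s. f' (s *\<^sub>R axis i 1))) (at 0)"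
    by simp
  then have "((\<lambda>s. f (x + s *\<^sub>R axis i 1)) has_real_derivative f' (axis i 1)) (at 0)"
    using linear_scale[OF has_derivative_linear[OF assms]]
    by (simp add: has_field_derivative_def mult_commute_abs)
  then show ?thesis
    unfolding partial_deriv_def by (rule DERIV_imp_deriv)
qed

lemma partial_deriv_DERIV:
  assumes "f differentiable (at (x + s *\<^sub>R axis i 1))"
  shows "((\<lambda>s. f (x + s *\<^sub>R axis i 1)) has_real_derivative partial_deriv i f (x + s *\<^sub>R axis i 1)) (at s)"
proof -
  from assms obtain f' where f': "(f has_derivative f') (at (x + s *\<^sub>R axis i 1))"
    by (auto simp: differentiable_def)
  have "((\<lambda>s. x + s *\<^sub>R axis i 1) has_derivative (\<lambda>s. s *\<^sub>R axis i 1)) (at s)"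
    by (auto intro!: derivative_eq_intros)
  from has_derivative_compose[OF this, of f f'] f'
  have "((\<lambda>s. f (x + s *\<^sub>R axis i 1)) has_derivative (\<lambda>s. f' (s *\<^sub>R axis i 1))) (at s)"
    by simp
  then show ?thesis
    using linear_scale[OF has_derivative_linear[OF f']]
    by (simp add: has_field_derivative_def partial_deriv_eq[OF f'] mult_commute_abs)
qed

text \<open>At the maximum \<open>g'\<close> vanishes. If L were positive, \<open>g'\<close> would
  be positive just to the right of 0, and by the mean value theorem g would exceed its maximum
  there.\<close>

lemma second_deriv_local_max:
  fixes g :: "real \<Rightarrow> real"
  assumes g: "\<And>s. (g has_real_derivative g' s) (at s)" and g': "(g' has_real_derivative L) (at 0)"
    and "d > 0" and max: "\<And>s. \<bar>s\<bar> < d \<Longrightarrow> g s \<le> g 0"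
  shows "L \<le> 0"
proof (rule ccontr)
  assume "\<not> L \<le> 0"
  have "g' 0 = 0"
    using DERIV_local_max[OF g \<open>d > 0\<close>] max by simp
  with DERIV_pos_inc_right[OF g'] \<open>\<not> L \<le> 0\<close> obtain e where e: "e > 0" "\<And>h. 0 < h \<Longrightarrow> h < e \<Longrightarrow> g' h > 0"
    by auto
  define s where "s = min d e / 2"
  have s: "0 < s" "s < d" "s < e" using \<open>d > 0\<close> e by (auto simp: s_def)
  obtain z where z: "0 < z" "z < s" "g s - g 0 = (s - 0) * g' z"
    using MVT2[of 0 s g g'] s g by auto
  with e(2)[of z] s have "g s - g 0 > 0" by simp
  with max[of s] s show False by simp
qed

text \<open>Decay at infinity replaces a boundary condition: a positive value at x forces the
  maximum over a large ball into the interior, where all pure second derivatives are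
  nonpositive.\<close>

lemma laplacian_maximum_principle:
  fixes w :: "real^'n::finite \<Rightarrow> real"
  assumes C2: "C2 w" and lim: "(w \<longlongrightarrow> 0) at_infinity" and lap: "\<And>x. laplacian w x \<ge> 0"
  shows "w x \<le> 0"
proof (rule ccontr)
  assume "\<not> w x \<le> 0"
  then have wx: "w x > 0" by simp
  from lim wx have "eventually (\<lambda>y. \<bar>w y\<bar> < w x / 2) at_infinity"
    by (auto simp: tendsto_iff dist_real_def elim: allE[of _ "w x / 2"])
  then obtain b where b: "\<And>y. norm y \<ge> b \<Longrightarrow> \<bar>w y\<bar> < w x / 2"
    by (auto simp: eventually_at_infinity)
  define R where "R = max b (norm x) + 1"
  have R: "R > 0" "R \<ge> b" "norm x \<le> R"
    using norm_ge_zero[of x] unfolding R_def by linarith+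
  \<comment> \<open>Since \<open>\<epsilon> * R\<^sup>2 = w x / 4\<close>, the perturbed function
    stays below \<open>w x / 2 + w x / 4\<close> on the sphere of radius R, hence below its value at
    x.\<close>
  define \<epsilon> where "\<epsilon> = w x / (4 * R\<^sup>2)"
  have \<epsilon>: "\<epsilon> > 0" "\<epsilon> * R\<^sup>2 = w x / 4" using wx R by (auto simp: \<epsilon>_def)
  \<comment> \<open>the perturbation makes the Laplacian positive at an interior maximum\<close>
  define v where "v y = w y + \<epsilon> * (y \<bullet> y)" for y
  have dw: "w differentiable (at y)" "partial_deriv i w differentiable (at y)" for y i
    using C2 by (auto simp: C2_def)
  have "continuous_on (cball 0 R) v"
    unfolding v_def using dw(1)
    by (intro continuous_intros continuous_at_imp_continuous_on ballI differentiable_imp_continuous_within) auto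
  then obtain z where z: "z \<in> cball 0 R" "\<And>y. y \<in> cball 0 R \<Longrightarrow> v y \<le> v z"
    using continuous_attains_sup[of "cball 0 R" v] R by auto
  have "w x \<le> v x" using \<epsilon> by (simp add: v_def)
  also have "\<dots> \<le> v z" using R by (intro z(2)) simp
  finally have vz: "w x \<le> v z" .
  have zR: "norm z < R"
  proof (rule ccontr)
    assume "\<not> norm z < R"
    with z(1) have "norm z = R" by simp
    with b[of z] R \<epsilon> vz wx show False
      by (simp add: v_def power2_norm_eq_inner[symmetric])
  qed
  have "partial_deriv i (partial_deriv i w) z \<le> - 2 * \<epsilon>" for i
  proof -
    let ?p = "\<lambda>s. z + s *\<^sub>R axis i (1::real)"
    have q: "((\<lambda>s. \<epsilon> * (?p s \<bullet> ?p s)) has_real_derivative 2 * \<epsilon> * (z $ i + s)) (at s)" for s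
      by (auto intro!: derivative_eq_intros simp: has_field_derivative_def inner_axis inner_axis' inner_add_left inner_add_right
          inner_axis_axis algebra_simps)
    have 1: "((\<lambda>s. v (?p s)) has_real_derivative partial_deriv i w (?p s) + 2 * \<epsilon> * (z $ i + s)) (at s)" for s
      unfolding v_def by (intro DERIV_add partial_deriv_DERIV dw q)
    have "((\<lambda>s. partial_deriv i w (?p s)) has_real_derivative partial_deriv i (partial_deriv i w) (?p 0)) (at 0)"
      by (rule partial_deriv_DERIV[OF dw(2)])
    moreover have "((\<lambda>s. 2 * \<epsilon> * (z $ i + s)) has_real_derivative 2 * \<epsilon>) (at 0)"
      by (auto intro!: derivative_eq_intros)
    ultimately have 2: "((\<lambda>s. partial_deriv i w (?p s) + 2 * \<epsilon> * (z $ i + s)) has_real_derivative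
       partial_deriv i (partial_deriv i w) (?p 0) + 2 * \<epsilon>) (at 0)"
      by (rule DERIV_add)
    have 3: "v (?p s) \<le> v (?p 0)" if "\<bar>s\<bar> < R - norm z" for s
    proof -
      have "norm (?p s) \<le> norm z + \<bar>s\<bar>"
        using norm_triangle_ineq[of z "s *\<^sub>R axis i 1"] by (simp add: norm_axis_1)
      then show ?thesis using that by (simp add: z(2))
    qed
    have "partial_deriv i (partial_deriv i w) (?p 0) + 2 * \<epsilon> \<le> 0"
      by (rule second_deriv_local_max[OF 1 2, of "R - norm z"]) (use zR 3 in auto)
    then show ?thesis by simp
  qed
  then have "laplacian w z \<le> (\<Sum>i\<in>(UNIV::'n set). - 2 * \<epsilon>)"
    unfolding laplacian_def by (intro sum_mono)
  also have "\<dots> < 0" using \<epsilon> by simp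
  finally show False using lap[of z] by simp
qed

lemma partial_deriv_diff:
  assumes "\<And>x. f differentiable (at x)" "\<And>x. g differentiable (at x)"
  shows "partial_deriv i (\<lambda>x. f x - g x) = (\<lambda>x. partial_deriv i f x - partial_deriv i g x)"
proof
  fix x
  obtain f' g' where *: "(f has_derivative f') (at x)" "(g has_derivative g') (at x)"
    using assms by (meson differentiable_def)
  show "partial_deriv i (\<lambda>x. f x - g x) x = partial_deriv i f x - partial_deriv i g x"
    using partial_deriv_eq[OF has_derivative_diff[OF *], of i] *[THEN partial_deriv_eq, of i] by simp
qed

lemma C2_diff:
  assumes "C2 f" "C2 g" shows "C2 (\<lambda>x. f x - g x)"
  using assms unfolding C2_def
  by (simp add: partial_deriv_diff differentiable_diff continuous_on_diff)

lemma laplacian_diff: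
  assumes "C2 f" "C2 g" shows "laplacian (\<lambda>x. f x - g x) x = laplacian f x - laplacian g x"
  using assms unfolding C2_def laplacian_def by (simp add: partial_deriv_diff sum_subtractf)

text \<open>The definite description needs uniqueness, which follows from the maximum principle
  applied to both differences of two candidates.\<close>

lemma inv_laplacian_eq:
  assumes "C2 w" "(w \<longlongrightarrow> 0) at_infinity" "\<And>x. laplacian w x = g x"
  shows "inv_laplacian g = w"
  unfolding inv_laplacian_def
proof (rule the_equality)
  show "C2 w \<and> (w \<longlongrightarrow> 0) at_infinity \<and> (\<forall>x. laplacian w x = g x)" using assms by blast
next
  fix w' assume w': "C2 w' \<and> (w' \<longlongrightarrow> 0) at_infinity \<and> (\<forall>x. laplacian w' x = g x)"
  have *: "f x - f' x \<le> 0" if "C2 f" "(f \<longlongrightarrow> 0) at_infinity" "C2 f'" "(f' \<longlongrightarrow> 0) at_infinity"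
      "\<And>x. laplacian f x = laplacian f' x" for f f' x
    using laplacian_maximum_principle[OF C2_diff[OF that(1,3)], of x] tendsto_diff[OF that(2,4)] that(5)
    by (simp add: laplacian_diff[OF that(1,3)])
  have "w' x - w x \<le> 0" "w x - w' x \<le> 0" for x
    by (rule *; use assms w' in simp)+
  then show "w' = w" by (intro ext order.antisym) simp_all
qed

section \<open>Derivatives of the radial moments and of the heat kernel\<close>

lemma has_derivative_vec_nth: "((\<lambda>x. x $ i) has_derivative (\<lambda>v. v $ i)) F"
  by (intro bounded_linear_imp_has_derivative bounded_linear_vec_nth)

lemma sum_axis_mult: "(\<Sum>i\<in>UNIV. axis i (1::real) $ h * f i) = f h"
  by (simp add: axis_def if_distrib[of "\<lambda>a. a * _"] sum.delta cong: if_cong)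

lemma radial_heat_moment_deriv:
  assumes "q \<ge> 0" "t > 0"
  shows "((\<lambda>x::'a::real_inner. heat_moment t q (x \<bullet> x)) has_derivative
     (\<lambda>v. - (1/2) * heat_moment t (q + 1) (x \<bullet> x) * (x \<bullet> v))) (at x)"
proof -
  have "((\<lambda>x. x \<bullet> x) has_derivative (\<lambda>v. 2 * (x \<bullet> v))) (at x)"
    by (auto intro!: derivative_eq_intros simp: inner_commute)
  from has_derivative_compose[OF this heat_moment_deriv[OF assms, unfolded has_field_derivative_def]]
  show ?thesis by (simp add: mult_ac)
qed

lemma heat_kernel_deriv:
  assumes "t > 0"
  shows "(heat_kernel t has_derivative (\<lambda>v. - heat_kernel t x / (2 * t) * (x \<bullet> v))) (at x)"
  unfolding heat_kernel_def[abs_def] power2_norm_eq_inner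
  using assms by (auto intro!: derivative_eq_intros simp: inner_commute field_simps)

lemma partial_deriv_heat_kernel:
  assumes "t > 0"
  shows "partial_deriv h (heat_kernel t) x = - heat_kernel t x / (2 * t) * x $ h"
  using partial_deriv_eq[OF heat_kernel_deriv[OF assms]] by (simp add: inner_axis)

lemma partial_deriv2_heat_kernel:
  assumes "t > 0"
  shows "partial_deriv k (partial_deriv h (heat_kernel t)) x =
     heat_kernel t x * (x $ h * x $ k / (4 * t\<^sup>2) - axis k 1 $ h / (2 * t))"
proof -
  have "((\<lambda>x. - 1 / (2 * t) * (heat_kernel t x * x $ h)) has_derivative
      (\<lambda>v. - 1 / (2 * t) * (heat_kernel t x * v $ h + - heat_kernel t x / (2 * t) * (x \<bullet> v) * x $ h))) (at x)"
    by (intro has_derivative_mult_right has_derivative_mult[OF heat_kernel_deriv has_derivative_vec_nth] assms)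
  also have "(\<lambda>x. - 1 / (2 * t) * (heat_kernel t x * x $ h)) = partial_deriv h (heat_kernel t)"
    by (simp add: partial_deriv_heat_kernel[OF assms] fun_eq_iff)
  finally have "(partial_deriv h (heat_kernel t) has_derivative
      (\<lambda>v. - 1 / (2 * t) * (heat_kernel t x * v $ h + - heat_kernel t x / (2 * t) * (x \<bullet> v) * x $ h))) (at x)" .
  from partial_deriv_eq[OF this] show ?thesis
    by (simp add: inner_axis power2_eq_square algebra_simps)
qed

section \<open>The Oseen kernel\<close>

text \<open>This is \<open>- \<integral>\<^sub>t\<^sup>\<infinity> \<partial>\<^sub>h\<partial>\<^sub>k G\<^sub>s ds\<close>, where \<open>G\<close> is the heat kernel and \<open>axis h 1 $ k\<close> is the Kronecker
  delta.\<close>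

definition oseen_potential :: "real \<Rightarrow> 'n::finite \<Rightarrow> 'n \<Rightarrow> real^'n \<Rightarrow> real" where
  "oseen_potential t h k x = (4 * pi) powr (- real CARD('n) / 2) / 2 *
     (axis h 1 $ k * heat_moment t (real CARD('n) / 2 - 1) (x \<bullet> x) -
      x $ h * x $ k / 2 * heat_moment t (real CARD('n) / 2) (x \<bullet> x))"

text \<open>Each factor \<open>norm x\<close> is at most \<open>sqrt t + norm x\<close> and thus
  costs one order of decay. In dimension d, the pairs of j and q used below give order
  \<open>- d\<close> for the potential and \<open>- d - 1\<close> for its gradient.\<close>

lemma norm_heat_moment_le:
  fixes x :: "'a::real_inner"
  assumes "q \<ge> 0" "t > 0"
  shows "norm x ^ j * heat_moment t q (x \<bullet> x)
    \<le> (32 * (q + 1)) powr (q + 1) * (sqrt t + norm x) powr (real j - 2 * (q + 1))"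
proof -
  have D: "sqrt t + norm x > 0" using assms by (simp add: add_pos_nonneg)
  have "norm x ^ j * heat_moment t q (x \<bullet> x)
      \<le> (sqrt t + norm x) ^ j * ((32 * (q + 1)) powr (q + 1) * (sqrt t + norm x) powr (- 2 * (q + 1)))"
    using heat_moment_bound[OF assms, of "norm x"] assms
    by (intro mult_mono power_mono) (auto simp: power2_norm_eq_inner heat_moment_nonneg)
  also have "\<dots> = (32 * (q + 1)) powr (q + 1) * ((sqrt t + norm x) powr real j * (sqrt t + norm x) powr (- 2 * (q + 1)))"
    using D by (simp add: powr_realpow)
  also have "(sqrt t + norm x) powr real j * (sqrt t + norm x) powr (- 2 * (q + 1)) =
      (sqrt t + norm x) powr (real j - 2 * (q + 1))"
    by (simp add: powr_add[symmetric] algebra_simps)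
  finally show ?thesis .
qed

lemma abs_axis_le_1: "\<bar>axis i (1::real) $ j\<bar> \<le> 1"
  by (simp add: axis_def)

text \<open>In dimension d, \<open>p = d / 2 - 1\<close> is nonnegative because
  \<open>d \<ge> 2\<close>. The functions \<open>w1 i\<close> and \<open>w2 j i\<close> turn out to
  be the first and second partial derivatives of the potential, in the form produced by the product
  rule; factors such as \<open>axis i 1 $ h\<close> are derivatives of coordinates.\<close>

context
  fixes t :: real and h k :: "'n::finite" and p c :: real
    and H0 H1 H2 H3 :: "real^'n \<Rightarrow> real" and w1 :: "'n \<Rightarrow> real^'n \<Rightarrow> real"
    and w2 :: "'n \<Rightarrow> 'n \<Rightarrow> real^'n \<Rightarrow> real"
  assumes card: "CARD('n) \<ge> 2" and t: "t > 0"
  defines "p \<equiv> real CARD('n) / 2 - 1" and "c \<equiv> (4 * pi) powr (- real CARD('n) / 2)"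
    and "H0 \<equiv> \<lambda>x. heat_moment t p (x \<bullet> x)" and "H1 \<equiv> \<lambda>x. heat_moment t (p + 1) (x \<bullet> x)"
    and "H2 \<equiv> \<lambda>x. heat_moment t (p + 2) (x \<bullet> x)" and "H3 \<equiv> \<lambda>x. heat_moment t (p + 3) (x \<bullet> x)"
    and "w1 \<equiv> \<lambda>i x. c / 2 * (- (axis h 1 $ k * x $ i / 2 * H1 x)
       - (axis i 1 $ h * x $ k + axis i 1 $ k * x $ h) / 2 * H1 x + x $ h * x $ k * x $ i / 4 * H2 x)"
    and "w2 \<equiv> \<lambda>j i x. c / 2 * (- (axis h 1 $ k * axis j 1 $ i / 2 * H1 x) + axis h 1 $ k * x $ i * x $ j / 4 * H2 x
       - (axis i 1 $ h * axis j 1 $ k + axis i 1 $ k * axis j 1 $ h) / 2 * H1 x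
       + (axis i 1 $ h * x $ k + axis i 1 $ k * x $ h) * x $ j / 4 * H2 x
       + (axis j 1 $ h * x $ k * x $ i + x $ h * axis j 1 $ k * x $ i + x $ h * x $ k * axis j 1 $ i) / 4 * H2 x
       - x $ h * x $ k * x $ i * x $ j / 8 * H3 x)"
begin

private lemma p_nonneg: "p \<ge> 0" using card by (simp add: p_def)

private lemma potential_eq: "oseen_potential t h k = (\<lambda>x. c / 2 * (axis h 1 $ k * H0 x - x $ h * x $ k / 2 * H1 x))"
  unfolding oseen_potential_def[abs_def] c_def H0_def H1_def p_def by simp

private lemma H_deriv:
  "(H0 has_derivative (\<lambda>v. - (1/2) * H1 x * (x \<bullet> v))) (at x)"
  "(H1 has_derivative (\<lambda>v. - (1/2) * H2 x * (x \<bullet> v))) (at x)"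
  "(H2 has_derivative (\<lambda>v. - (1/2) * H3 x * (x \<bullet> v))) (at x)"
  unfolding H0_def H1_def H2_def H3_def
  using radial_heat_moment_deriv[of p t x] radial_heat_moment_deriv[of "p + 1" t x]
    radial_heat_moment_deriv[of "p + 2" t x] p_nonneg t by (simp_all add: add.assoc)

private lemma H_continuous: "continuous_on S H1" "continuous_on S H2" "continuous_on S H3"
  using has_derivative_continuous[OF H_deriv(2)] has_derivative_continuous[OF H_deriv(3)]
    has_derivative_continuous[OF radial_heat_moment_deriv[of "p + 3" t]] p_nonneg t
  unfolding H3_def by (auto intro!: continuous_at_imp_continuous_on)

private lemma potential_deriv1:
  "(oseen_potential t h k has_derivative (\<lambda>v. c / 2 * (- (axis h 1 $ k * (x \<bullet> v) / 2 * H1 x)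
       - (v $ h * x $ k + v $ k * x $ h) / 2 * H1 x + x $ h * x $ k * (x \<bullet> v) / 4 * H2 x))) (at x)"
  unfolding potential_eq
  by (rule has_derivative_eq_rhs, (rule derivative_intros H_deriv has_derivative_vec_nth numeral_neq_zero)+)
    (auto simp: fun_eq_iff algebra_simps)

private lemma potential_partial: "partial_deriv i (oseen_potential t h k) = w1 i"
  using partial_deriv_eq[OF potential_deriv1] unfolding w1_def
  by (auto simp: fun_eq_iff inner_axis)

private lemma potential_deriv2:
  "(w1 i has_derivative (\<lambda>v. c / 2 * (- (axis h 1 $ k * v $ i / 2 * H1 x) + axis h 1 $ k * x $ i * (x \<bullet> v) / 4 * H2 x
       - (axis i 1 $ h * v $ k + axis i 1 $ k * v $ h) / 2 * H1 x
       + (axis i 1 $ h * x $ k + axis i 1 $ k * x $ h) * (x \<bullet> v) / 4 * H2 x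
       + (v $ h * x $ k * x $ i + x $ h * v $ k * x $ i + x $ h * x $ k * v $ i) / 4 * H2 x
       - x $ h * x $ k * x $ i * (x \<bullet> v) / 8 * H3 x))) (at x)"
  unfolding w1_def
  by (rule has_derivative_eq_rhs, (rule derivative_intros H_deriv has_derivative_vec_nth numeral_neq_zero)+)
    (auto simp: fun_eq_iff algebra_simps add_divide_distrib diff_divide_distrib)

private lemma potential_partial2: "partial_deriv j (w1 i) = w2 j i"
  using partial_deriv_eq[OF potential_deriv2] unfolding w2_def
  by (auto simp: fun_eq_iff inner_axis)

lemma C2_potential: "C2 (oseen_potential t h k)"
  unfolding C2_def
proof (intro conjI allI)
  show "oseen_potential t h k differentiable (at x)" for x
    using potential_deriv1 by (auto simp: differentiable_def)
  show "partial_deriv i (oseen_potential t h k) differentiable (at x)" for i x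
    unfolding potential_partial using potential_deriv2 by (auto simp: differentiable_def)
  show "continuous_on UNIV (partial_deriv i (partial_deriv j (oseen_potential t h k)))" for i j
    unfolding potential_partial potential_partial2 w2_def
    by (intro continuous_intros H_continuous) auto
qed

text \<open>The trace of \<open>w2\<close> contains \<open>x \<bullet> x\<close> times
  \<open>H2\<close> and \<open>H3\<close>. The recurrence lowers the order of both; because
  \<open>p = d / 2 - 1\<close> in dimension d, all moments then cancel and only the boundary terms
  survive. They add up to the second derivative of the heat kernel.\<close>

lemma laplacian_potential:
  "laplacian (oseen_potential t h k) x = partial_deriv k (partial_deriv h (heat_kernel t)) x"
proof -
  define e where "e = exp (- (x \<bullet> x) / (4 * t))"
  define E where "E = t powr (- (p + 2)) * e"
  have r1: "(x \<bullet> x) / 4 * H2 x = (p + 2) * H1 x - E"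
    using heat_moment_rec[of "p + 1" t "x \<bullet> x"] p_nonneg t
    unfolding H1_def H2_def E_def e_def by (simp add: add.assoc)
  have "(x \<bullet> x) / 4 * H3 x = (p + 3) * H2 x - t powr (- (p + 3)) * e"
    using heat_moment_rec[of "p + 2" t "x \<bullet> x"] p_nonneg t
    unfolding H3_def H2_def e_def by (simp add: add.assoc)
  moreover have "t powr (- (p + 3)) * e = E / t"
  proof -
    have "- (p + 3) = - (p + 2) - 1" by simp
    then show ?thesis unfolding E_def using t by (simp only: powr_diff) simp
  qed
  ultimately have r2: "(x \<bullet> x) / 4 * H3 x = (p + 3) * H2 x - E / t" by simp
  \<comment> \<open>The exponents satisfy \<open>- d / 2 = - (p + 2) + 1\<close> in dimension d;
    this matches the prefactor of the heat kernel with the boundary term \<open>E\<close>.\<close>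
  have "t powr (- real CARD('n) / 2) = t powr (- (p + 2)) * t"
    using t by (simp add: p_def powr_add[symmetric] powr_mult_base mult.commute)
  then have G: "heat_kernel t x = c * E * t"
    unfolding heat_kernel_def power2_norm_eq_inner c_def E_def e_def using t
    by (simp add: powr_mult)
  have s1: "(\<Sum>i\<in>UNIV. x $ i * x $ i) = x \<bullet> x" by (simp add: inner_vec_def)
  define \<delta> :: real where "\<delta> = axis h 1 $ k"
  have sym: "axis k 1 $ h = \<delta>" by (auto simp: axis_def \<delta>_def)
  have diag: "axis i (1::real) $ i = 1" for i :: 'n by (simp add: axis_def)
  have "w2 i i x = c / 2 * (- (\<delta> / 2 * H1 x) + (\<delta> / 4 * H2 x) * (x $ i * x $ i)
       - H1 x * (axis i 1 $ h * axis i 1 $ k)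
       + (x $ k / 2 * H2 x) * (axis i 1 $ h * x $ i) + (x $ h / 2 * H2 x) * (axis i 1 $ k * x $ i)
       + x $ h * x $ k / 4 * H2 x - (x $ h * x $ k / 8 * H3 x) * (x $ i * x $ i))" for i
    unfolding w2_def \<delta>_def[symmetric] diag by (simp add: field_simps)
  then have "laplacian (oseen_potential t h k) x = (\<Sum>i\<in>UNIV. c / 2 * (- (\<delta> / 2 * H1 x) + (\<delta> / 4 * H2 x) * (x $ i * x $ i)
       - H1 x * (axis i 1 $ h * axis i 1 $ k)
       + (x $ k / 2 * H2 x) * (axis i 1 $ h * x $ i) + (x $ h / 2 * H2 x) * (axis i 1 $ k * x $ i)
       + x $ h * x $ k / 4 * H2 x - (x $ h * x $ k / 8 * H3 x) * (x $ i * x $ i)))"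
    unfolding laplacian_def potential_partial potential_partial2 by (simp only:)
  also have "\<dots> = c / 2 * (- (real CARD('n) * (\<delta> / 2 * H1 x)) + (\<delta> / 4 * H2 x) * (x \<bullet> x) - H1 x * \<delta>
       + (x $ k / 2 * H2 x) * x $ h + (x $ h / 2 * H2 x) * x $ k + real CARD('n) * (x $ h * x $ k / 4 * H2 x)
       - (x $ h * x $ k / 8 * H3 x) * (x \<bullet> x))"
    unfolding sum_distrib_left[symmetric] sum.distrib sum_subtractf sum_axis_mult s1 by (simp add: sum_negf \<delta>_def mult_ac)
  also have "\<dots> = c / 2 * (\<delta> * ((x \<bullet> x) / 4 * H2 x - (p + 2) * H1 x)
       - x $ h * x $ k / 2 * ((x \<bullet> x) / 4 * H3 x - (p + 3) * H2 x))"
    unfolding p_def by (simp add: field_simps)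
  also have "\<dots> = c / 2 * (- (\<delta> * E) + x $ h * x $ k / 2 * (E / t))"
    unfolding r1 r2 by simp
  also have "\<dots> = partial_deriv k (partial_deriv h (heat_kernel t)) x"
    unfolding partial_deriv2_heat_kernel[OF t] G sym using t by (simp add: field_simps power2_eq_square)
  finally show ?thesis .
qed

private lemma c_nonneg: "c \<ge> 0" by (simp add: c_def)

private lemma H_nonneg: "H0 x \<ge> 0" "H1 x \<ge> 0" "H2 x \<ge> 0"
  by (simp_all add: H0_def H1_def H2_def heat_moment_nonneg)

text \<open>Both summands decay like \<open>(sqrt t + norm x) powr (- d)\<close>, as
  \<open>2 * (p + 1)\<close> is the dimension d. This is the condition at infinity that
  \<open>inv_laplacian\<close> demands.\<close>

lemma potential_tendsto: "(oseen_potential t h k \<longlongrightarrow> 0) at_infinity"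
proof -
  define B where "B = c / 2 * ((32 * (p + 1)) powr (p + 1) + (32 * (p + 2)) powr (p + 2))"
  have le: "\<bar>oseen_potential t h k x\<bar> \<le> B * (sqrt t + norm x) powr (- (2 * (p + 1)))" for x
  proof -
    have "\<bar>axis h 1 $ k * H0 x - x $ h * x $ k / 2 * H1 x\<bar> \<le> \<bar>axis h 1 $ k\<bar> * \<bar>H0 x\<bar> + \<bar>x $ h\<bar> * \<bar>x $ k\<bar> / 2 * \<bar>H1 x\<bar>"
      by (rule order_trans[OF abs_triangle_ineq4]) (simp add: abs_mult)
    also have "\<dots> \<le> 1 * H0 x + norm x * norm x / 1 * H1 x"
      using H_nonneg[of x] component_le_norm_cart[of x] abs_axis_le_1
      by (intro add_mono mult_mono frac_le) auto
    also have "\<dots> = norm x ^ 0 * heat_moment t p (x \<bullet> x) + norm x ^ 2 * heat_moment t (p + 1) (x \<bullet> x)"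
      by (simp add: H0_def H1_def power2_eq_square)
    also have "\<dots> \<le> (32 * (p + 1)) powr (p + 1) * (sqrt t + norm x) powr (real 0 - 2 * (p + 1)) +
       (32 * ((p + 1) + 1)) powr ((p + 1) + 1) * (sqrt t + norm x) powr (real 2 - 2 * ((p + 1) + 1))"
      using p_nonneg by (intro add_mono norm_heat_moment_le t) auto
    also have "\<dots> = ((32 * (p + 1)) powr (p + 1) + (32 * (p + 2)) powr (p + 2)) * (sqrt t + norm x) powr (- (2 * (p + 1)))"
      by (simp add: algebra_simps)
    finally have "c / 2 * \<bar>axis h 1 $ k * H0 x - x $ h * x $ k / 2 * H1 x\<bar> \<le> c / 2 *
        (((32 * (p + 1)) powr (p + 1) + (32 * (p + 2)) powr (p + 2)) * (sqrt t + norm x) powr (- (2 * (p + 1))))"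
      using c_nonneg by (intro mult_left_mono) auto
    then show ?thesis
      unfolding potential_eq B_def abs_mult[of "c / 2"] mult.assoc[of "c / 2"] using c_nonneg by simp
  qed
  have "((\<lambda>x. B * (sqrt t + norm x) powr (- (2 * (p + 1)))) \<longlongrightarrow> B * 0) at_infinity"
    using p_nonneg
    by (intro tendsto_mult tendsto_const tendsto_neg_powr filterlim_tendsto_add_at_top[OF tendsto_const]
        filterlim_norm_at_top) simp
  then have lim: "((\<lambda>x. B * (sqrt t + norm x) powr (- (2 * (p + 1)))) \<longlongrightarrow> 0) at_infinity"
    by (simp only: mult_zero_right)
  show ?thesis
  proof (rule Lim_null_comparison[OF _ lim])
    show "\<forall>\<^sub>F x in at_infinity. norm (oseen_potential t h k x) \<le> B * (sqrt t + norm x) powr (- (2 * (p + 1)))"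
      unfolding real_norm_def by (intro always_eventually allI le)
  qed
qed

text \<open>The projected field has only a k-th component, so its divergence is the single second
  derivative found in \<open>laplacian_potential\<close>, and uniqueness identifies its inverse
  Laplacian with the explicit potential.\<close>

lemma oseen_kernel_eq:
  "oseen_kernel t h k x = axis k (partial_deriv h (heat_kernel t) x) - grad (oseen_potential t h k) x"
proof -
  have "partial_deriv i (\<lambda>y. axis k (partial_deriv h (heat_kernel t) y) $ i) =
      (if i = k then partial_deriv k (partial_deriv h (heat_kernel t)) else (\<lambda>_. 0))" for i
    by (auto simp: axis_def partial_deriv_def)
  then have "divergence (\<lambda>z. axis k (partial_deriv h (heat_kernel t) z)) = partial_deriv k (partial_deriv h (heat_kernel t))"
    unfolding divergence_def[abs_def] by (simp add: if_distribR fun_eq_iff sum.delta)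
  then have "inv_laplacian (divergence (\<lambda>z. axis k (partial_deriv h (heat_kernel t) z))) = oseen_potential t h k"
    by (intro inv_laplacian_eq C2_potential potential_tendsto) (simp add: laplacian_potential)
  then show ?thesis unfolding oseen_kernel_def leray_def by simp
qed

text \<open>Dropping the nonnegative \<open>H2\<close> term from the recurrence bounds the Gaussian
  by a multiple of \<open>H1\<close>, so this part of the Oseen kernel obeys the same moment
  estimates as the potential.\<close>

private lemma abs_partial_heat_kernel_le:
  "\<bar>partial_deriv h (heat_kernel t) x\<bar> \<le> c / 2 * (p + 2) * (norm x * H1 x)"
proof -
  define e where "e = exp (- (x \<bullet> x) / (4 * t))"
  have "(x \<bullet> x) / 4 * H2 x = (p + 2) * H1 x - t powr (- (p + 2)) * e"
    using heat_moment_rec[of "p + 1" t "x \<bullet> x"] p_nonneg t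
    unfolding H1_def H2_def e_def by (simp add: add.assoc)
  moreover have "(x \<bullet> x) / 4 * H2 x \<ge> 0" using H_nonneg by simp
  ultimately have le: "t powr (- (p + 2)) * e \<le> (p + 2) * H1 x" by linarith
  have "t powr (- real CARD('n) / 2) = t powr (- (p + 2)) * t"
    using t by (simp add: p_def powr_add[symmetric] powr_mult_base mult.commute)
  then have G: "heat_kernel t x = c * (t powr (- (p + 2)) * e) * t"
    unfolding heat_kernel_def power2_norm_eq_inner c_def e_def using t
    by (simp add: powr_mult)
  have "\<bar>partial_deriv h (heat_kernel t) x\<bar> = c / 2 * (t powr (- (p + 2)) * e) * \<bar>x $ h\<bar>"
    unfolding partial_deriv_heat_kernel[OF t] G using t c_nonneg by (simp add: abs_mult e_def)
  also have "\<dots> \<le> c / 2 * ((p + 2) * H1 x) * norm x"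
    using c_nonneg p_nonneg H_nonneg
    by (intro mult_mono[OF mult_left_mono[OF le] component_le_norm_cart] mult_nonneg_nonneg) auto
  finally show ?thesis by (simp add: mult_ac)
qed

private lemma abs_partial_potential_le:
  "\<bar>partial_deriv i (oseen_potential t h k) x\<bar> \<le> c / 2 * (2 * (norm x * H1 x) + norm x ^ 3 * H2 x)"
proof -
  have n: "\<bar>x $ i\<bar> \<le> norm x" for i by (rule component_le_norm_cart)
  have a: "\<bar>axis i (1::real) $ j\<bar> * \<bar>x $ l\<bar> \<le> norm x" for i j l :: 'n
    using mult_mono[OF abs_axis_le_1 n] by simp
  have "\<bar>axis h 1 $ k * x $ i / 2 * H1 x\<bar> \<le> norm x / 2 * H1 x"
    unfolding abs_mult abs_divide abs_numeral using a H_nonneg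
    by (intro mult_mono[of _ "_ / 2"] divide_right_mono) auto
  moreover have "\<bar>(axis i 1 $ h * x $ k + axis i 1 $ k * x $ h) / 2 * H1 x\<bar> \<le> (norm x + norm x) / 2 * H1 x"
    unfolding abs_mult abs_divide abs_numeral using a H_nonneg
    by (intro mult_mono divide_right_mono order_trans[OF abs_triangle_ineq] add_mono) (auto simp: abs_mult)
  moreover have "\<bar>x $ h * x $ k * x $ i / 4 * H2 x\<bar> \<le> norm x * norm x * norm x / 1 * H2 x"
    unfolding abs_mult abs_divide abs_numeral using n H_nonneg
    by (intro mult_mono frac_le) auto
  ultimately have "\<bar>- (axis h 1 $ k * x $ i / 2 * H1 x)
       - (axis i 1 $ h * x $ k + axis i 1 $ k * x $ h) / 2 * H1 x + x $ h * x $ k * x $ i / 4 * H2 x\<bar>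
    \<le> norm x / 2 * H1 x + (norm x + norm x) / 2 * H1 x + norm x * norm x * norm x / 1 * H2 x"
    by linarith
  also have "\<dots> \<le> 2 * (norm x * H1 x) + norm x ^ 3 * H2 x"
    using H_nonneg[of x] by (simp add: power3_eq_cube algebra_simps)
  finally show ?thesis
    unfolding potential_partial w1_def using c_nonneg by (simp add: abs_mult mult_left_mono)
qed

text \<open>The constant is written out so that it visibly depends on the dimension alone; one
  constant then serves all t, h, k and x. Both \<open>norm x * H1 x\<close> and
  \<open>norm x ^ 3 * H2 x\<close> have order \<open>- (d + 1)\<close> in dimension d.\<close>

lemma norm_oseen_kernel_le_explicit:
  "norm (oseen_kernel t h k x) \<le> c / 2 * ((p + 2) * (32 * (p + 2)) powr (p + 2) + real CARD('n) *
      (2 * (32 * (p + 2)) powr (p + 2) + (32 * (p + 3)) powr (p + 3))) / (sqrt t + norm x) ^ (CARD('n) + 1)"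
proof -
  let ?R = "(sqrt t + norm x) powr (- (real CARD('n) + 1))"
  have ring: "b * (a * (P * R)) + n * (b * (2 * (P * R) + Q * R)) = b * (a * P + n * (2 * P + Q)) * R"
    for a b n P Q R :: real by (simp add: algebra_simps)
  have D: "sqrt t + norm x > 0" using t by (simp add: add_pos_nonneg)
  have H1: "norm x * H1 x \<le> (32 * (p + 2)) powr (p + 2) * ?R"
    using norm_heat_moment_le[of "p + 1" t x 1] p_nonneg t unfolding H1_def by (simp add: p_def algebra_simps)
  have H2: "norm x ^ 3 * H2 x \<le> (32 * (p + 3)) powr (p + 3) * ?R"
    using norm_heat_moment_le[of "p + 2" t x 3] p_nonneg t unfolding H2_def by (simp add: p_def algebra_simps)
  have "norm (oseen_kernel t h k x) \<le> \<bar>partial_deriv h (heat_kernel t) x\<bar> + norm (grad (oseen_potential t h k) x)"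
    unfolding oseen_kernel_eq by (rule order_trans[OF norm_triangle_ineq4]) (simp add: norm_eq_sqrt_inner[of "axis _ _"] inner_axis_axis)
  also have "norm (grad (oseen_potential t h k) x) \<le> (\<Sum>i\<in>UNIV. \<bar>partial_deriv i (oseen_potential t h k) x\<bar>)"
    using norm_le_l1_cart[of "grad (oseen_potential t h k) x"] by (simp add: grad_def)
  also have "\<dots> \<le> (\<Sum>i\<in>(UNIV::'n set). c / 2 * (2 * (norm x * H1 x) + norm x ^ 3 * H2 x))"
    by (intro sum_mono abs_partial_potential_le)
  also have "\<dots> = real CARD('n) * (c / 2 * (2 * (norm x * H1 x) + norm x ^ 3 * H2 x))"
    by simp
  also have "\<dots> \<le> real CARD('n) * (c / 2 * (2 * ((32 * (p + 2)) powr (p + 2) * ?R) + (32 * (p + 3)) powr (p + 3) * ?R))"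
    using c_nonneg H1 H2 by (intro mult_left_mono add_mono) auto
  also have "\<bar>partial_deriv h (heat_kernel t) x\<bar> \<le> c / 2 * ((p + 2) * ((32 * (p + 2)) powr (p + 2) * ?R))"
    using H1 c_nonneg p_nonneg
    by (intro order_trans[OF abs_partial_heat_kernel_le, unfolded mult.assoc] mult_left_mono) auto
  finally have "norm (oseen_kernel t h k x) \<le> c / 2 * ((p + 2) * ((32 * (p + 2)) powr (p + 2) * ?R)) +
      real CARD('n) * (c / 2 * (2 * ((32 * (p + 2)) powr (p + 2) * ?R) + (32 * (p + 3)) powr (p + 3) * ?R))"
    by linarith
  also have "\<dots> = c / 2 * ((p + 2) * (32 * (p + 2)) powr (p + 2) + real CARD('n) *
      (2 * (32 * (p + 2)) powr (p + 2) + (32 * (p + 3)) powr (p + 3))) * ?R"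
    by (rule ring)
  also have "?R = 1 / (sqrt t + norm x) ^ (CARD('n) + 1)"
    using D unfolding powr_minus_divide by (simp add: powr_realpow[symmetric] powr_add)
  finally show ?thesis by simp
qed

end

lemma norm_oseen_kernel_le:
  assumes "CARD('n::finite) \<ge> 2"
  shows "\<exists>A\<ge>0. \<forall>t>0. \<forall>(h::'n) k x. norm (oseen_kernel t h k x) \<le> A / (sqrt t + norm x) ^ (CARD('n) + 1)"
proof -
  define p where "p = real CARD('n) / 2 - 1"
  define A where "A = (4 * pi) powr (- real CARD('n) / 2) / 2 * ((p + 2) * (32 * (p + 2)) powr (p + 2) + real CARD('n) *
      (2 * (32 * (p + 2)) powr (p + 2) + (32 * (p + 3)) powr (p + 3)))"
  have "p \<ge> 0" using assms by (simp add: p_def)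
  then have "0 \<le> A"
    unfolding A_def by (intro mult_nonneg_nonneg add_nonneg_nonneg) auto
  moreover have "norm (oseen_kernel t h k x) \<le> A / (sqrt t + norm x) ^ (CARD('n) + 1)"
    if "t > 0" for t and h k :: 'n and x
    unfolding A_def p_def by (rule norm_oseen_kernel_le_explicit[OF assms that])
  ultimately show ?thesis by blast
qed

section \<open>Integral estimates\<close>

text \<open>The ball of radius \<open>2 ^ k * r\<close> has volume proportional to
  \<open>(2 ^ k * r) ^ d\<close> in dimension d and carries a value proportional to
  \<open>1 / (2 ^ k * r) ^ (d + 1)\<close>. The k-th term is therefore a constant times
  \<open>1 / (2 ^ k * r)\<close>, and the series is geometric.\<close>

lemma nn_integral_inverse_power_le:
  fixes x :: "'a::euclidean_space"
  assumes "r > 0"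
  shows "(\<integral>\<^sup>+y. ennreal (1 / (r + norm (x - y)) ^ (DIM('a) + 1)) \<partial>lborel)
    \<le> ennreal (2 ^ (DIM('a) + 2) * unit_ball_vol (DIM('a)) / r)"
proof -
  let ?N = "DIM('a) + 1" and ?V = "unit_ball_vol (DIM('a))"
  \<comment> \<open>the integrand is dominated by a sum over the dyadic balls around \<open>x\<close>\<close>
  define f where "f k y = ennreal (2 ^ ?N / (2 ^ k * r) ^ ?N) * indicator (ball x (2 ^ k * r)) y" for k :: nat and y
  have "ennreal (1 / (r + norm (x - y)) ^ ?N) \<le> (\<Sum>k. f k y)" for y
  proof -
    obtain n where "norm (x - y) / r < 2 ^ n"
      using real_arch_pow[of 2] by auto
    then have ex: "\<exists>n. norm (x - y) < 2 ^ n * r"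
      using assms by (auto simp: field_simps)
    define k where "k = (LEAST n. norm (x - y) < 2 ^ n * r)"
    have k: "norm (x - y) < 2 ^ k * r" unfolding k_def by (rule LeastI_ex[OF ex])
    \<comment> \<open>For positive k, minimality gives
      \<open>2 ^ (k - 1) * r \<le> norm (x - y)\<close>; for \<open>k = 0\<close> the summand r on
      the right suffices.\<close>
    have k2: "2 ^ k * r \<le> 2 * (r + norm (x - y))"
    proof (cases k)
      case 0
      then show ?thesis using assms norm_ge_zero[of "x - y"] by simp
    next
      case (Suc j)
      then have "\<not> norm (x - y) < 2 ^ j * r"
        unfolding k_def by (metis not_less_Least lessI)
      then show ?thesis using Suc assms by simp
    qed
    have "(2 ^ k * r) ^ ?N \<le> (2 * (r + norm (x - y))) ^ ?N"
      using k2 assms by (intro power_mono) auto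
    moreover have "r + norm (x - y) > 0" using assms by (simp add: add_pos_nonneg)
    ultimately have "1 / (r + norm (x - y)) ^ ?N \<le> 2 ^ ?N / (2 ^ k * r) ^ ?N"
      using assms unfolding power_mult_distrib[of 2 "r + _"] by (simp add: divide_simps mult_ac)
    then have "ennreal (1 / (r + norm (x - y)) ^ ?N) \<le> f k y"
      using k by (simp add: f_def dist_norm ennreal_leI)
    also have "f k y \<le> (\<Sum>k. f k y)"
      using sum_le_suminf[of "\<lambda>k. f k y" "{k}"] by simp
    finally show ?thesis .
  qed
  then have "(\<integral>\<^sup>+y. ennreal (1 / (r + norm (x - y)) ^ ?N) \<partial>lborel) \<le> (\<integral>\<^sup>+y. (\<Sum>k. f k y) \<partial>lborel)"
    by (intro nn_integral_mono)
  also have "\<dots> = (\<Sum>k. \<integral>\<^sup>+y. f k y \<partial>lborel)"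
    unfolding f_def
    by (intro nn_integral_suminf borel_measurable_times_ennreal borel_measurable_const borel_measurable_indicator) simp
  also have "\<dots> = (\<Sum>k. ennreal (2 ^ ?N * ?V / r * (1 / 2) ^ k))"
  proof (intro arg_cong[where f = suminf] ext)
    fix k :: nat
    have "(\<integral>\<^sup>+y. f k y \<partial>lborel) = ennreal (2 ^ ?N / (2 ^ k * r) ^ ?N) * ennreal (?V * (2 ^ k * r) ^ DIM('a))"
      unfolding f_def using assms by (subst nn_integral_cmult_indicator) (simp_all add: emeasure_ball)
    also have "\<dots> = ennreal (2 ^ ?N / (2 ^ k * r) ^ ?N * (?V * (2 ^ k * r) ^ DIM('a)))"
      using assms by (intro ennreal_mult[symmetric]) auto
    also have "2 ^ ?N / (2 ^ k * r) ^ ?N * (?V * (2 ^ k * r) ^ DIM('a)) = 2 ^ ?N * ?V / r * (1 / 2) ^ k"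
      using assms by (simp add: field_simps)
    finally show "(\<integral>\<^sup>+y. f k y \<partial>lborel) = ennreal (2 ^ ?N * ?V / r * (1 / 2) ^ k)" .
  qed
  also have "\<dots> = ennreal (2 ^ ?N * ?V / r * (1 / (1 - 1 / 2)))"
    using assms by (intro suminf_ennreal_eq sums_mult geometric_sums) auto
  also have "2 ^ ?N * ?V / r * (1 / (1 - 1 / 2)) = 2 ^ (DIM('a) + 2) * ?V / r" by simp
  finally show ?thesis .
qed

lemma
  fixes x :: "'a::euclidean_space"
  assumes "r > 0"
  shows integrable_inverse_power: "integrable lebesgue (\<lambda>y. 1 / (r + norm (x - y)) ^ (DIM('a) + 1))"
    and integral_inverse_power_le: "(\<integral>y. 1 / (r + norm (x - y)) ^ (DIM('a) + 1) \<partial>lebesgue)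
      \<le> 2 ^ (DIM('a) + 2) * unit_ball_vol (DIM('a)) / r"
proof -
  have meas: "(\<lambda>y. 1 / (r + norm (x - y)) ^ (DIM('a) + 1)) \<in> borel_measurable lborel" by simp
  have "(\<integral>\<^sup>+y. ennreal (norm (1 / (r + norm (x - y)) ^ (DIM('a) + 1))) \<partial>lborel) < \<infinity>"
    using le_less_trans[OF nn_integral_inverse_power_le[OF assms, of x]] assms
    by (simp add: abs_of_nonneg)
  then have int: "integrable lborel (\<lambda>y. 1 / (r + norm (x - y)) ^ (DIM('a) + 1))"
    using meas by (intro integrableI_bounded)
  then show "integrable lebesgue (\<lambda>y. 1 / (r + norm (x - y)) ^ (DIM('a) + 1))"
    using meas by (simp add: integrable_completion)
  have "ennreal (\<integral>y. 1 / (r + norm (x - y)) ^ (DIM('a) + 1) \<partial>lborel) =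
      (\<integral>\<^sup>+y. ennreal (1 / (r + norm (x - y)) ^ (DIM('a) + 1)) \<partial>lborel)"
    using int assms by (intro nn_integral_eq_integral[symmetric]) auto
  also note nn_integral_inverse_power_le[OF assms, of x]
  finally have "(\<integral>y. 1 / (r + norm (x - y)) ^ (DIM('a) + 1) \<partial>lborel) \<le> 2 ^ (DIM('a) + 2) * unit_ball_vol (DIM('a)) / r"
    by (rule ennreal_le_iff[THEN iffD1, rotated]) (use assms in simp)
  then show "(\<integral>y. 1 / (r + norm (x - y)) ^ (DIM('a) + 1) \<partial>lebesgue) \<le> 2 ^ (DIM('a) + 2) * unit_ball_vol (DIM('a)) / r"
    unfolding integral_completion[OF meas] .
qed

text \<open>Moving the weight from y to x costs \<open>(X / Y) powr \<alpha>\<close>, which is at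
  most \<open>(1 + q) ^ N\<close> because \<open>\<alpha> \<le> real N\<close>. Up to constants this
  is \<open>1 + q ^ N\<close>, and in the second summand \<open>z ^ N\<close> cancels the kernel and
  leaves \<open>1 / Y ^ N\<close>. Writing \<open>0 - y\<close> makes that term an instance of the
  kernel itself.\<close>

lemma weight_kernel_le:
  fixes x y :: "'a::real_normed_vector"
  assumes "r > 0" "0 \<le> \<alpha>" "\<alpha> \<le> real N"
  shows "(1 + norm y) powr (- \<alpha>) / (r + norm (x - y)) ^ N
    \<le> 2 ^ (N + 1) * (1 + norm x) powr (- \<alpha>) * (1 / (r + norm (x - y)) ^ N + 1 / (1 + norm (0 - y)) ^ N)"
proof -
  define X Y z q where "X = 1 + norm x" and "Y = 1 + norm y" and "z = norm (x - y)" and "q = z / Y"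
  have pos: "X > 0" "Y > 0" "z \<ge> 0" "q \<ge> 0" "r + z > 0"
    using assms by (auto simp: X_def Y_def z_def q_def add_pos_nonneg)
  have "X \<le> Y + z"
    using norm_triangle_sub[of x y] by (simp add: X_def Y_def z_def)
  then have "X / Y \<le> 1 + q" using pos by (simp add: q_def field_simps)
  have "(X / Y) powr \<alpha> \<le> (1 + q) powr \<alpha>"
    using \<open>X / Y \<le> 1 + q\<close> pos assms by (intro powr_mono2) auto
  also have "\<dots> \<le> (1 + q) powr real N"
    using assms pos by (intro powr_mono) auto
  also have "\<dots> = (1 + q) ^ N"
    using pos by (intro powr_realpow) auto
  also have "\<dots> \<le> (2 * max 1 q) ^ N"
    using pos by (intro power_mono) auto
  also have "\<dots> = 2 ^ N * max 1 q ^ N" by (rule power_mult_distrib)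
  also have "max 1 q ^ N \<le> 1 + q ^ N"
    using pos by (auto simp: max_def)
  also have "2 ^ N * (1 + q ^ N) \<le> 2 ^ (N + 1) * (1 + q ^ N)"
    using pos by (intro mult_right_mono) auto
  finally have ratio: "(X / Y) powr \<alpha> \<le> 2 ^ (N + 1) * (1 + q ^ N)" by simp
  have "q ^ N / (r + z) ^ N \<le> 1 / Y ^ N"
  proof -
    have "z ^ N \<le> (r + z) ^ N" using assms pos by (intro power_mono) auto
    then show ?thesis using pos by (simp add: q_def power_divide divide_simps)
  qed
  have "Y powr (- \<alpha>) / (r + z) ^ N = X powr (- \<alpha>) * ((X / Y) powr \<alpha>) / (r + z) ^ N"
    using pos by (simp add: powr_divide powr_minus field_simps)
  also have "\<dots> \<le> X powr (- \<alpha>) * (2 ^ (N + 1) * (1 + q ^ N)) / (r + z) ^ N"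
    using pos ratio by (intro divide_right_mono mult_left_mono) auto
  also have "\<dots> = 2 ^ (N + 1) * X powr (- \<alpha>) * (1 / (r + z) ^ N + q ^ N / (r + z) ^ N)"
    by (simp add: add_divide_distrib algebra_simps)
  also have "\<dots> \<le> 2 ^ (N + 1) * X powr (- \<alpha>) * (1 / (r + z) ^ N + 1 / Y ^ N)"
    using \<open>q ^ N / (r + z) ^ N \<le> 1 / Y ^ N\<close> by (intro mult_left_mono add_mono) auto
  finally show ?thesis by (simp add: X_def Y_def z_def)
qed

text \<open>The two terms of \<open>weight_kernel_le\<close> have integrals of size
  \<open>1 / r\<close> and 1; the upper bound R on r turns their sum into a multiple of
  \<open>1 / r\<close>. Later R is the square root of the time horizon.\<close>

lemma
  fixes x :: "'a::euclidean_space"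
  assumes "0 < r" "r \<le> R" "0 \<le> \<alpha>" "\<alpha> \<le> real (DIM('a) + 1)"
  shows integrable_weight_kernel:
      "integrable lebesgue (\<lambda>y. (1 + norm y) powr (- \<alpha>) / (r + norm (x - y)) ^ (DIM('a) + 1))"
    and integral_weight_kernel_le:
      "(\<integral>y. (1 + norm y) powr (- \<alpha>) / (r + norm (x - y)) ^ (DIM('a) + 1) \<partial>lebesgue)
       \<le> 2 ^ (2 * DIM('a) + 4) * unit_ball_vol (DIM('a)) * (1 + R) / r * (1 + norm x) powr (- \<alpha>)"
proof -
  let ?N = "DIM('a) + 1" and ?c = "2 ^ (DIM('a) + 2) * unit_ball_vol (DIM('a))"
  let ?f = "\<lambda>y. (1 + norm y) powr (- \<alpha>) / (r + norm (x - y)) ^ ?N"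
  let ?g = "\<lambda>y. 2 ^ (?N + 1) * (1 + norm x) powr (- \<alpha>) * (1 / (r + norm (x - y)) ^ ?N + 1 / (1 + norm (0 - y)) ^ ?N)"
  have int: "integrable lebesgue (\<lambda>y. 1 / (r + norm (x - y)) ^ ?N)" "integrable lebesgue (\<lambda>y::'a. 1 / (1 + norm (0 - y)) ^ ?N)"
    using assms by (intro integrable_inverse_power; simp)+
  then have g: "integrable lebesgue ?g"
    by (intro integrable_mult_right Bochner_Integration.integrable_add)
  have le: "?f y \<le> ?g y" for y
    using assms by (intro weight_kernel_le) auto
  show f: "integrable lebesgue ?f"
  proof (rule Bochner_Integration.integrable_bound[OF g])
    have "?f \<in> borel_measurable borel" by simp
    then show "?f \<in> borel_measurable lebesgue" by (simp add: borel_measurable_if_I measurable_completion)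
    show "AE y in lebesgue. norm (?f y) \<le> norm (?g y)"
      using le assms by (intro AE_I2) (smt (verit) divide_nonneg_nonneg norm_ge_zero powr_ge_zero real_norm_def zero_le_power)
  qed
  have "integral\<^sup>L lebesgue ?f \<le> integral\<^sup>L lebesgue ?g"
    using f g le by (intro integral_mono) auto
  also have "\<dots> = 2 ^ (?N + 1) * (1 + norm x) powr (- \<alpha>) *
      ((\<integral>y. 1 / (r + norm (x - y)) ^ ?N \<partial>lebesgue) + (\<integral>y. 1 / (1 + norm ((0::'a) - y)) ^ ?N \<partial>lebesgue))"
    using int by simp
  also have "\<dots> \<le> 2 ^ (?N + 1) * (1 + norm x) powr (- \<alpha>) * (?c / r + ?c / 1)"
    using assms by (intro mult_left_mono add_mono integral_inverse_power_le) auto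
  also have "?c / r + ?c / 1 = ?c * (1 + r) / r" using assms by (simp add: field_simps)
  also have "2 ^ (?N + 1) * (1 + norm x) powr (- \<alpha>) * (?c * (1 + r) / r) \<le> 2 ^ (?N + 1) * (1 + norm x) powr (- \<alpha>) * (?c * (1 + R) / r)"
    using assms by (intro divide_right_mono mult_left_mono) auto
  also have "2 ^ (?N + 1) * (1 + norm x) powr (- \<alpha>) * (?c * (1 + R) / r) =
     2 ^ (2 * DIM('a) + 4) * unit_ball_vol (DIM('a)) * (1 + R) / r * (1 + norm x) powr (- \<alpha>)"
  proof -
    have "2 ^ (2 * DIM('a) + 4) = (2::real) ^ (?N + 1) * 2 ^ (DIM('a) + 2)"
      unfolding power_add[symmetric] by (rule arg_cong[of _ _ "power 2"]) simp
    then show ?thesis by simp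
  qed
  finally show "integral\<^sup>L lebesgue ?f \<le> 2 ^ (2 * DIM('a) + 4) * unit_ball_vol (DIM('a)) * (1 + R) / r * (1 + norm x) powr (- \<alpha>)" .
qed

text \<open>A non-integrable f has Bochner integral 0, so domination by g alone suffices. In the
  Duhamel term this spares any discussion of the measurability of the integrands in space and
  time.\<close>

lemma norm_integral_le:
  fixes f :: "'a \<Rightarrow> 'b::{banach, second_countable_topology}"
  assumes "integrable M g" and le: "AE x in M. norm (f x) \<le> g x"
  shows "norm (integral\<^sup>L M f) \<le> integral\<^sup>L M g"
proof (cases "integrable M f")
  case True
  then have "(\<integral>x. norm (f x) \<partial>M) \<le> integral\<^sup>L M g"
    using assms by (intro integral_mono_AE integrable_norm)
  then show ?thesis by (rule order_trans[OF integral_norm_bound])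
next
  case False
  have "AE x in M. 0 \<le> g x" using le by eventually_elim (auto intro: order_trans[OF norm_ge_zero])
  then show ?thesis using False by (simp add: not_integrable_integral_eq integral_nonneg_AE)
qed

text \<open>The primitive \<open>- 4 * (t - s) powr (1 / 4)\<close> is continuous up to the singular
  endpoint \<open>s = t\<close>, so the fundamental theorem with differentiability only in the
  interior applies.\<close>

lemma has_integral_powr_singular:
  assumes "t \<ge> 0"
  shows "((\<lambda>s::real. (t - s) powr (- 3 / 4)) has_integral 4 * t powr (1 / 4)) {0..t}"
proof -
  have "((\<lambda>s. (t - s) powr (- 3 / 4)) has_integral (- 4 * (t - t) powr (1 / 4) - - 4 * (t - 0) powr (1 / 4))) {0..t}"
  proof (rule fundamental_theorem_of_calculus_interior)
    show "continuous_on {0..t} (\<lambda>s. - 4 * (t - s) powr (1 / 4))"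
      by (intro continuous_intros continuous_on_powr') auto
    show "((\<lambda>s. - 4 * (t - s) powr (1 / 4)) has_vector_derivative (t - s) powr (- 3 / 4)) (at s)"
      if "s \<in> {0<..<t}" for s
      using that unfolding has_real_derivative_iff_has_vector_derivative[symmetric]
      by (auto intro!: derivative_eq_intros)
  qed (use assms in auto)
  then show ?thesis by simp
qed

text \<open>With \<open>\<tau> = t - s\<close>, the factor \<open>\<mu>\<^bsup>-1/4\<^esup>\<close> comes from \<open>\<tau>\<^bsup>-1/2\<^esup> e\<^bsup>-\<mu>\<tau>\<^esup> \<le> \<mu>\<^bsup>-1/4\<^esup> \<tau>\<^bsup>-3/4\<^esup>\<close>.\<close>

lemma norm_time_integral_le:
  fixes f :: "real \<Rightarrow> 'b::{banach, second_countable_topology}"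
  assumes "\<mu> > 0" "t \<ge> 0" "M \<ge> 0"
    and le: "\<And>s. 0 \<le> s \<Longrightarrow> s < t \<Longrightarrow> norm (f s) \<le> M * exp (\<mu> * s) / sqrt (t - s)"
  shows "norm (LINT s:{0..t}|lebesgue. f s) \<le> 4 * M * exp (\<mu> * t) * t powr (1 / 4) / \<mu> powr (1 / 4)"
proof -
  let ?g = "\<lambda>s. (t - s) powr (- 3 / 4)"
  have "?g absolutely_integrable_on {0..t}"
    using has_integral_powr_singular[OF assms(2)] by (intro nonnegative_absolutely_integrable_1) auto
  then have gi: "set_integrable lebesgue {0..t} ?g" .
  then have g: "(LINT s:{0..t}|lebesgue. ?g s) = 4 * t powr (1 / 4)"
    using has_integral_powr_singular[OF assms(2)]
    by (simp add: set_lebesgue_integral_eq_integral integral_unique)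
  define c where "c = M * exp (\<mu> * t) / \<mu> powr (1 / 4)"
  have *: "norm (f s) \<le> c * ?g s" if "0 \<le> s" "s < t" for s
  proof -
    let ?\<tau> = "t - s"
    have e: "exp (\<mu> * s) = exp (\<mu> * t) * exp (- (\<mu> * ?\<tau>))"
      by (simp add: mult_exp_exp algebra_simps)
    have "(\<mu> * ?\<tau>) powr (1 / 4) \<le> exp (\<mu> * ?\<tau> / 4)"
    proof -
      have "\<mu> * ?\<tau> \<le> exp (\<mu> * ?\<tau>)" using exp_ge_add_one_self[of "\<mu> * ?\<tau>"] by linarith
      then have "(\<mu> * ?\<tau>) powr (1 / 4) \<le> exp (\<mu> * ?\<tau>) powr (1 / 4)"
        using that assms by (intro powr_mono2) auto
      then show ?thesis by (simp add: powr_def)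
    qed
    also have "\<dots> \<le> exp (\<mu> * ?\<tau>)" using that assms by simp
    finally have "\<mu> powr (1 / 4) * ?\<tau> powr (1 / 4) * exp (- (\<mu> * ?\<tau>)) \<le> 1"
      unfolding powr_mult exp_minus by (simp only: divide_inverse[symmetric] divide_le_eq_1_pos exp_gt_zero)
    then have "exp (- (\<mu> * ?\<tau>)) \<le> 1 / \<mu> powr (1 / 4) * ?\<tau> powr (- (1 / 4))"
      using that assms by (simp add: powr_minus field_simps)
    then have "M * exp (\<mu> * t) * exp (- (\<mu> * ?\<tau>)) / sqrt ?\<tau> \<le> M * exp (\<mu> * t) * (1 / \<mu> powr (1 / 4) * ?\<tau> powr (- (1 / 4))) / sqrt ?\<tau>"
      using that assms by (intro divide_right_mono mult_left_mono) auto
    also have "\<dots> = c * (?\<tau> powr (- (1 / 4)) / ?\<tau> powr (1 / 2))"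
      using that unfolding c_def by (simp add: powr_half_sqrt)
    also have "?\<tau> powr (- (1 / 4)) / ?\<tau> powr (1 / 2) = ?g s"
      unfolding powr_diff[symmetric] by simp
    finally have "M * exp (\<mu> * t) * exp (- (\<mu> * ?\<tau>)) / sqrt ?\<tau> \<le> c * ?g s" .
    with le[OF that] show ?thesis unfolding e by (simp add: mult.assoc)
  qed
  \<comment> \<open>The bound on f is available only for \<open>s < t\<close>; the endpoint is a
    null set.\<close>
  have "AE s in lebesgue. s \<noteq> t"
    by (intro AE_I'[of "{t}"]) (auto simp: null_sets_completionI)
  then have "AE s in lebesgue. norm (indicator {0..t} s *\<^sub>R f s) \<le> indicator {0..t} s *\<^sub>R (c * ?g s)"
    by eventually_elim (use * in \<open>auto simp: indicator_def\<close>)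
  moreover have "set_integrable lebesgue {0..t} (\<lambda>s. c * ?g s)"
    using gi by simp
  ultimately have "norm (LINT s:{0..t}|lebesgue. f s) \<le> (LINT s:{0..t}|lebesgue. c * ?g s)"
    unfolding set_lebesgue_integral_def set_integrable_def by (intro norm_integral_le)
  also have "\<dots> = c * (4 * t powr (1 / 4))" using g by simp
  finally show ?thesis by (simp add: c_def mult_ac)
qed

section \<open>The Duhamel term\<close>

lemma norm_tensor_kernel_le:
  fixes v :: "real^'n::finite" and F :: "'n \<Rightarrow> 'n \<Rightarrow> real^'n"
  assumes "norm (F h k) \<le> b" "(norm v)\<^sup>2 \<le> g"
  shows "norm ((tensor v v $ h $ k) *\<^sub>R F h k) \<le> g * b"
proof -
  have "\<bar>v $ h * v $ k\<bar> \<le> norm v * norm v"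
    unfolding abs_mult by (intro mult_mono component_le_norm_cart) auto
  then show ?thesis
    using assms order_trans[OF norm_ge_zero assms(1)]
    by (simp add: tensor_def power2_eq_square) (meson mult_mono norm_ge_zero abs_ge_zero order_trans)
qed

lemma norm_heat_leray_div_le:
  fixes v :: "real^'n::finite \<Rightarrow> real^'n"
  assumes kernel: "\<And>(h::'n) k z. norm (oseen_kernel \<tau> h k z) \<le> A / (sqrt \<tau> + norm z) ^ (CARD('n) + 1)"
    and v: "AE y in lebesgue. (norm (v y))\<^sup>2 \<le> g y"
    and int: "integrable lebesgue (\<lambda>y. g y / (sqrt \<tau> + norm (x - y)) ^ (CARD('n) + 1))"
  shows "norm (heat_leray_div \<tau> (\<lambda>y. tensor (v y) (v y)) x)
    \<le> (real CARD('n))\<^sup>2 * A * (\<integral>y. g y / (sqrt \<tau> + norm (x - y)) ^ (CARD('n) + 1) \<partial>lebesgue)"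
proof -
  let ?I = "\<integral>y. g y / (sqrt \<tau> + norm (x - y)) ^ (CARD('n) + 1) \<partial>lebesgue"
  have "norm (\<integral>y. (tensor (v y) (v y) $ h $ k) *\<^sub>R oseen_kernel \<tau> h k (x - y) \<partial>lebesgue) \<le> A * ?I" for h k
  proof -
    have "norm (\<integral>y. (tensor (v y) (v y) $ h $ k) *\<^sub>R oseen_kernel \<tau> h k (x - y) \<partial>lebesgue)
        \<le> (\<integral>y. A * (g y / (sqrt \<tau> + norm (x - y)) ^ (CARD('n) + 1)) \<partial>lebesgue)"
    proof (rule norm_integral_le)
      show "integrable lebesgue (\<lambda>y. A * (g y / (sqrt \<tau> + norm (x - y)) ^ (CARD('n) + 1)))"
        using int by (rule integrable_mult_right)
      show "AE y in lebesgue. norm ((tensor (v y) (v y) $ h $ k) *\<^sub>R oseen_kernel \<tau> h k (x - y))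
          \<le> A * (g y / (sqrt \<tau> + norm (x - y)) ^ (CARD('n) + 1))"
        using v
      proof eventually_elim
        case (elim y)
        from norm_tensor_kernel_le[of "\<lambda>h k. oseen_kernel \<tau> h k (x - y)", OF kernel elim]
        show ?case by (simp add: mult.commute)
      qed
    qed
    then show ?thesis by (simp only: integral_mult_right_zero)
  qed
  then have "norm (heat_leray_div \<tau> (\<lambda>y. tensor (v y) (v y)) x) \<le> (\<Sum>h\<in>(UNIV::'n set). \<Sum>k\<in>(UNIV::'n set). A * ?I)"
    unfolding heat_leray_div_def by (intro sum_norm_le)
  then show ?thesis by (simp add: power2_eq_square mult_ac)
qed

text \<open>The constant c is fixed before u, \<open>\<mu>\<close>, p, q and
  \<open>\<alpha>\<close>, so that \<open>\<mu>\<close> can later be chosen large in terms of c. The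
  summand q is treated as a weight with exponent 0.\<close>

lemma norm_duhamel_le:
  assumes "CARD('n::finite) \<ge> 2"
  obtains c where "c \<ge> 0" "\<And>(u :: real \<Rightarrow> real^'n \<Rightarrow> real^'n) \<mu> t \<alpha> p q x.
    \<lbrakk>\<mu> > 0; 0 \<le> t; t \<le> S; 0 \<le> \<alpha>; \<alpha> \<le> real CARD('n) + 1; p \<ge> 0; q \<ge> 0;
     \<And>s. s \<in> {0..<t} \<Longrightarrow>
       AE y in lebesgue. (norm (u s y))\<^sup>2 \<le> exp (\<mu> * s) * (p * (1 + norm y) powr (- \<alpha>) + q)\<rbrakk> \<Longrightarrow>
    norm (LINT s:{0..t}|lebesgue. heat_leray_div (t - s) (\<lambda>y. tensor (u s y) (u s y)) x)
      \<le> c / \<mu> powr (1 / 4) * exp (\<mu> * t) * (p * (1 + norm x) powr (- \<alpha>) + q)"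
proof -
  let ?d = "CARD('n)"
  from norm_oseen_kernel_le[OF assms] obtain A where A: "A \<ge> 0"
    and kernel: "\<And>t (h::'n) k x. t > 0 \<Longrightarrow> norm (oseen_kernel t h k x) \<le> A / (sqrt t + norm x) ^ (?d + 1)"
    by blast
  \<comment> \<open>Taking \<open>max S 0\<close> keeps the constants nonnegative for every S;
    whenever some t with \<open>0 \<le> t\<close> and \<open>t \<le> S\<close> exists, it equals
    S.\<close>
  define w where "w = 2 ^ (2 * ?d + 4) * unit_ball_vol ?d * (1 + sqrt (max S 0))"
  have w: "w \<ge> 0" by (simp add: w_def)
  define c where "c = 4 * ((real ?d)\<^sup>2 * A * w) * (max S 0) powr (1 / 4)"
  have le: "norm (LINT s:{0..t}|lebesgue. heat_leray_div (t - s) (\<lambda>y. tensor (u s y) (u s y)) x)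
      \<le> c / \<mu> powr (1 / 4) * exp (\<mu> * t) * (p * (1 + norm x) powr (- \<alpha>) + q)"
    if "\<mu> > 0" "0 \<le> t" "t \<le> S" "0 \<le> \<alpha>" "\<alpha> \<le> real ?d + 1" "p \<ge> 0" "q \<ge> 0"
      and u: "\<And>s. s \<in> {0..<t} \<Longrightarrow> AE y in lebesgue. (norm (u s y))\<^sup>2 \<le> exp (\<mu> * s) * (p * (1 + norm y) powr (- \<alpha>) + q)"
    for u :: "real \<Rightarrow> real^'n \<Rightarrow> real^'n" and \<mu> t \<alpha> p q x
  proof -
    define W where "W = p * (1 + norm x) powr (- \<alpha>) + q"
    have W: "W \<ge> 0" using that by (simp add: W_def)
    have "norm (heat_leray_div (t - s) (\<lambda>y. tensor (u s y) (u s y)) x)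
        \<le> ((real ?d)\<^sup>2 * A * w) * W * exp (\<mu> * s) / sqrt (t - s)" if s: "0 \<le> s" "s < t" for s
    proof -
      define r where "r = sqrt (t - s)"
      have r: "0 < r" "r \<le> sqrt (max S 0)" using s \<open>t \<le> S\<close> by (auto simp: r_def)
      have b: "integrable lebesgue (\<lambda>y. (1 + norm y) powr (- \<beta>) / (r + norm (x - y)) ^ (?d + 1))"
        "(\<integral>y. (1 + norm y) powr (- \<beta>) / (r + norm (x - y)) ^ (?d + 1) \<partial>lebesgue) \<le> w / r * (1 + norm x) powr (- \<beta>)"
        if "0 \<le> \<beta>" "\<beta> \<le> real ?d + 1" for \<beta>
        using integrable_weight_kernel[OF r, of \<beta> x] integral_weight_kernel_le[OF r, of \<beta> x] that
        by (auto simp: w_def)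
      \<comment> \<open>The base must be nonzero here, since \<open>0 powr 0 = 0\<close>.\<close>
      have one: "(1 + norm y) powr (- 0) = 1" for y :: "real^'n"
        using norm_ge_zero[of y] by (simp del: norm_ge_zero)
      note b0 = b[of 0, unfolded one]
      let ?k = "\<lambda>y. (1 + norm y) powr (- \<alpha>) / (r + norm (x - y)) ^ (?d + 1)"
      let ?l = "\<lambda>y. 1 / (r + norm (x - y)) ^ (?d + 1)"
      have eq: "(\<lambda>y. exp (\<mu> * s) * (p * (1 + norm y) powr (- \<alpha>) + q) / (r + norm (x - y)) ^ (?d + 1)) =
         (\<lambda>y. exp (\<mu> * s) * (p * ?k y + q * ?l y))"
        by (simp add: fun_eq_iff add_divide_distrib[symmetric])
      have kl: "integrable lebesgue (\<lambda>y. p * ?k y)" "integrable lebesgue (\<lambda>y. q * ?l y)"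
        using b(1)[of \<alpha>] b0(1) \<open>0 \<le> \<alpha>\<close> \<open>\<alpha> \<le> real ?d + 1\<close> by (simp_all only: integrable_mult_right)
      then have int: "integrable lebesgue (\<lambda>y. p * ?k y + q * ?l y)"
        by (rule Bochner_Integration.integrable_add)
      have "norm (heat_leray_div (t - s) (\<lambda>y. tensor (u s y) (u s y)) x) \<le> (real ?d)\<^sup>2 * A *
         (\<integral>y. exp (\<mu> * s) * (p * (1 + norm y) powr (- \<alpha>) + q) / (sqrt (t - s) + norm (x - y)) ^ (?d + 1) \<partial>lebesgue)"
      proof (rule norm_heat_leray_div_le)
        show "norm (oseen_kernel (t - s) h k z) \<le> A / (sqrt (t - s) + norm z) ^ (?d + 1)" for h k :: 'n and z
          using s by (intro kernel) simp
        show "AE y in lebesgue. (norm (u s y))\<^sup>2 \<le> exp (\<mu> * s) * (p * (1 + norm y) powr (- \<alpha>) + q)"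
          using u s by simp
        show "integrable lebesgue (\<lambda>y. exp (\<mu> * s) * (p * (1 + norm y) powr (- \<alpha>) + q) / (sqrt (t - s) + norm (x - y)) ^ (?d + 1))"
          unfolding r_def[symmetric] eq using int by (rule integrable_mult_right)
      qed
      also have "(\<integral>y. exp (\<mu> * s) * (p * (1 + norm y) powr (- \<alpha>) + q) / (sqrt (t - s) + norm (x - y)) ^ (?d + 1) \<partial>lebesgue)
          = exp (\<mu> * s) * (p * integral\<^sup>L lebesgue ?k + q * integral\<^sup>L lebesgue ?l)"
        using Bochner_Integration.integral_add[OF kl]
        unfolding r_def[symmetric] eq integral_mult_right_zero by (rule arg_cong)
      also have "(real ?d)\<^sup>2 * A * (exp (\<mu> * s) * (p * integral\<^sup>L lebesgue ?k + q * integral\<^sup>L lebesgue ?l))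
          \<le> (real ?d)\<^sup>2 * A * (exp (\<mu> * s) * (p * (w / r * (1 + norm x) powr (- \<alpha>)) + q * (w / r * 1)))"
        using b(2)[of \<alpha>] b0(2) A \<open>0 \<le> \<alpha>\<close> \<open>\<alpha> \<le> real ?d + 1\<close> \<open>p \<ge> 0\<close> \<open>q \<ge> 0\<close>
        by (intro mult_left_mono add_mono) auto
      also have "\<dots> = ((real ?d)\<^sup>2 * A * w) * W * exp (\<mu> * s) / sqrt (t - s)"
        using r(1) unfolding r_def[symmetric] W_def by (simp add: field_simps)
      finally show ?thesis .
    qed
    then have "norm (LINT s:{0..t}|lebesgue. heat_leray_div (t - s) (\<lambda>y. tensor (u s y) (u s y)) x)
      \<le> 4 * (((real ?d)\<^sup>2 * A * w) * W) * exp (\<mu> * t) * t powr (1 / 4) / \<mu> powr (1 / 4)"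
      using \<open>\<mu> > 0\<close> \<open>0 \<le> t\<close> A w W by (intro norm_time_integral_le) auto
    also have "\<dots> \<le> 4 * (((real ?d)\<^sup>2 * A * w) * W) * exp (\<mu> * t) * (max S 0) powr (1 / 4) / \<mu> powr (1 / 4)"
      using \<open>0 \<le> t\<close> \<open>t \<le> S\<close> A w W by (intro divide_right_mono mult_left_mono powr_mono2) auto
    finally show ?thesis by (simp add: c_def W_def mult_ac)
  qed
  have "c \<ge> 0" using A w by (simp add: c_def)
  then show thesis using le by (rule that)
qed

section \<open>Decay of the mild solution\<close>

theorem proposition3p7:
  fixes a :: "real^'n::finite \<Rightarrow> real^'n"
    and u :: "real \<Rightarrow> real^'n \<Rightarrow> real^'n"
    and T :: ereal
    and m :: "real^'n \<Rightarrow> real"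
    and C :: "real \<Rightarrow> real"
    and K \<theta> :: real
  assumes "CARD('n) \<ge> 2"
    and "a \<in> Linf" and "divergence_free a"
    and "0 < T"
    and "u \<in> Cw T" and "mild_solution T a u"
    and "(real CARD('n) + 1) / 2 < \<theta>" and "\<theta> \<le> real CARD('n) + 1"
    and "\<forall>x. 1 \<le> m x \<and> m x \<le> K * (1 + norm x) powr (real CARD('n) + 1 - \<theta>)"
    and "\<forall>T'. ereal T' < T \<longrightarrow> bounded (C ` {0..T'})"
    and "\<forall>t\<ge>0. ereal t < T \<longrightarrow>
           (\<forall>x. norm (heat t a x) \<le> C t * (1 + norm x) powr (- \<theta>) * inverse (m x))"
  shows "\<forall>T'. ereal T' < T \<longrightarrow>
           (\<exists>C'. \<forall>t\<in>{0..T'}. AE x in lebesgue.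
              norm (u t x) \<le> C' * (1 + norm x) powr (- \<theta>) * inverse (m x))"
proof (intro allI impI)
  fix S :: real assume S: "ereal S < T"
  let ?N = "real CARD('n) + 1" and ?w = "\<lambda>x::real^'n. (1 + norm x) powr (- \<theta>)"
  let ?D = "\<lambda>t x. LINT s:{0..t}|lebesgue. heat_leray_div (t - s) (\<lambda>y. tensor (u s y) (u s y)) x"
  have \<theta>: "0 \<le> \<theta>" using assms(7) by (simp add: field_simps)
  have m: "1 \<le> m x" "m x \<le> K * (1 + norm x) powr (?N - \<theta>)" for x using assms(9) by auto
  have tT: "ereal t < T" if "t \<in> {0..S}" for t
    using that S by (intro le_less_trans[OF _ S]) simp
  have mild: "AE x in lebesgue. u t x = heat t a x - ?D t x" if "t \<in> {0..S}" for t
    using assms(6) tT[OF that] that unfolding mild_solution_def by auto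
  from assms(5) S obtain B0 where B0: "\<And>t. t \<in> {0..S} \<Longrightarrow> Linf_norm (u t) \<le> ereal B0"
    unfolding Cw_def by blast
  define B where "B = max B0 0"
  have B: "B \<ge> 0" by (simp add: B_def)
  have uB: "AE x in lebesgue. norm (u t x) \<le> B" if "t \<in> {0..S}" for t
    using esssup_AE[of "\<lambda>x. ereal (norm (u t x))" lebesgue]
  proof eventually_elim
    case (elim x)
    from order_trans[OF elim B0[OF that, unfolded Linf_norm_def]] show ?case by (simp add: B_def)
  qed
  from assms(10) S obtain C0 where C0: "C0 \<ge> 0" "\<And>t. t \<in> {0..S} \<Longrightarrow> \<bar>C t\<bar> \<le> C0"
    unfolding bounded_pos by (metis (mono_tags) imageI less_imp_le real_norm_def)
  have heat: "norm (heat t a x) \<le> C0 * ?w x * inverse (m x)" if "t \<in> {0..S}" for t x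
  proof -
    have "norm (heat t a x) \<le> C t * ?w x * inverse (m x)"
      using assms(11) tT[OF that] that by auto
    also have "\<dots> \<le> C0 * ?w x * inverse (m x)"
      using C0(2)[OF that] m[of x] by (intro mult_right_mono) auto
    finally show ?thesis .
  qed
  have heat': "norm (heat t a x) \<le> C0 * ?w x" if "t \<in> {0..S}" for t x
  proof -
    have "C0 * ?w x * inverse (m x) \<le> C0 * ?w x * 1"
      using C0 m[of x] by (intro mult_left_mono inverse_le_1_iff[THEN iffD2] mult_nonneg_nonneg) auto
    with heat[OF that, of x] show ?thesis by simp
  qed
  show "\<exists>C'. \<forall>t\<in>{0..S}. AE x in lebesgue. norm (u t x) \<le> C' * ?w x * inverse (m x)"
  proof (rule norm_duhamel_le[OF assms(1), where S = S])
    fix c :: real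
    assume c: "c \<ge> 0" and duhamel: "\<And>(u :: real \<Rightarrow> real^'n \<Rightarrow> real^'n) \<mu> t \<alpha> p q x.
      \<lbrakk>\<mu> > 0; 0 \<le> t; t \<le> S; 0 \<le> \<alpha>; \<alpha> \<le> ?N; p \<ge> 0; q \<ge> 0;
       \<And>s. s \<in> {0..<t} \<Longrightarrow>
         AE y in lebesgue. (norm (u s y))\<^sup>2 \<le> exp (\<mu> * s) * (p * (1 + norm y) powr (- \<alpha>) + q)\<rbrakk> \<Longrightarrow>
      norm (LINT s:{0..t}|lebesgue. heat_leray_div (t - s) (\<lambda>y. tensor (u s y) (u s y)) x)
        \<le> c / \<mu> powr (1 / 4) * exp (\<mu> * t) * (p * (1 + norm x) powr (- \<alpha>) + q)"
    \<comment> \<open>As \<open>\<mu> powr (1 / 4) = L\<close>, the Duhamel factor becomes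
      \<open>c * B / (2 * c * B + 1)\<close>, which is at most 1/2. The summand 1 keeps L positive
      when \<open>c * B = 0\<close>.\<close>
    define L where "L = 2 * c * B + 1"
    define \<mu> where "\<mu> = L powr 4"
    have L: "L > 0" using c B by (simp add: L_def add_nonneg_pos)
    have \<mu>: "\<mu> > 0" "\<mu> powr (1 / 4) = L"
      using L unfolding \<mu>_def powr_powr by simp_all
    have half: "c / \<mu> powr (1 / 4) * B \<le> 1 / 2"
      using L unfolding \<mu>(2) by (simp add: field_simps L_def)
    \<comment> \<open>One pass through the mild formulation. Bounding one of the two factors of the
      quadratic term by B makes that term linear in the assumed bound, and the choice of
      \<open>\<mu>\<close> halves it.\<close>
    have step: "AE x in lebesgue. norm (u t x) \<le> exp (\<mu> * t) * ((C0 + p / 2) * ?w x + q / 2)"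
      if "p \<ge> 0" "q \<ge> 0" and t: "t \<in> {0..S}"
        and u: "\<And>s. s \<in> {0..S} \<Longrightarrow> AE x in lebesgue. norm (u s x) \<le> exp (\<mu> * s) * (p * ?w x + q)" for p q t
      using mild[OF t]
    proof eventually_elim
      case (elim x)
      have "norm (?D t x) \<le> c / \<mu> powr (1 / 4) * exp (\<mu> * t) * ((B * p) * ?w x + B * q)"
      proof (rule duhamel)
        fix s assume s: "s \<in> {0..<t}"
        then have s': "s \<in> {0..S}" using t by auto
        show "AE y in lebesgue. (norm (u s y))\<^sup>2 \<le> exp (\<mu> * s) * (B * p * ?w y + B * q)"
          using uB[OF s'] u[OF s']
        proof eventually_elim
          case (elim y)
          then have "norm (u s y) * norm (u s y) \<le> B * (exp (\<mu> * s) * (p * ?w y + q))"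
            using B by (intro mult_mono) auto
          then show ?case by (simp add: power2_eq_square algebra_simps)
        qed
      qed (use \<mu> \<theta> assms(8) t that B in auto)
      also have "\<dots> = (c / \<mu> powr (1 / 4) * B) * (exp (\<mu> * t) * (p * ?w x + q))"
        by (simp add: algebra_simps add_divide_distrib)
      also have "\<dots> \<le> 1 / 2 * (exp (\<mu> * t) * (p * ?w x + q))"
        using that by (intro mult_right_mono half) auto
      finally have D: "norm (?D t x) \<le> 1 / 2 * (exp (\<mu> * t) * (p * ?w x + q))" .
      have "norm (u t x) \<le> norm (heat t a x) + norm (?D t x)"
        unfolding elim by (rule norm_triangle_ineq4)
      also have "\<dots> \<le> 1 * (C0 * ?w x) + 1 / 2 * (exp (\<mu> * t) * (p * ?w x + q))"
        using heat'[OF t, of x] D by simp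
      also have "\<dots> \<le> exp (\<mu> * t) * (C0 * ?w x) + 1 / 2 * (exp (\<mu> * t) * (p * ?w x + q))"
        using \<mu> t C0 by (intro add_right_mono mult_right_mono) auto
      finally show ?case by (simp add: algebra_simps)
    qed
    \<comment> \<open>The value \<open>2 * C0\<close> is the fixed point of the map sending p to
      \<open>C0 + p / 2\<close>, so each pass changes only the constant part, which is
      halved.\<close>
    have "\<forall>t\<in>{0..S}. AE x in lebesgue. norm (u t x) \<le> exp (\<mu> * t) * (2 * C0 * ?w x + B / 2 ^ n)" for n
    proof (induction n)
      case 0
      show ?case
      proof
        fix t assume t: "t \<in> {0..S}"
        show "AE x in lebesgue. norm (u t x) \<le> exp (\<mu> * t) * (2 * C0 * ?w x + B / 2 ^ 0)"
          using uB[OF t]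
        proof eventually_elim
          case (elim x)
          have "1 * B \<le> exp (\<mu> * t) * (2 * C0 * ?w x + B)"
            using \<mu> t B C0 by (intro mult_mono) auto
          with elim show ?case by simp
        qed
      qed
    next
      case (Suc n)
      show ?case
      proof
        fix t assume t: "t \<in> {0..S}"
        show "AE x in lebesgue. norm (u t x) \<le> exp (\<mu> * t) * (2 * C0 * ?w x + B / 2 ^ Suc n)"
          using step[of "2 * C0" "B / 2 ^ n" t] Suc t C0 B by (simp add: mult.commute)
      qed
    qed
    then have iter: "AE x in lebesgue. norm (u t x) \<le> exp (\<mu> * t) * (2 * C0 * ?w x + B / 2 ^ n)"
      if "t \<in> {0..S}" for t n using that by blast
    define M where "M = exp (\<mu> * S) * (2 * C0)"
    have decay: "AE x in lebesgue. norm (u t x) \<le> M * ?w x" if t: "t \<in> {0..S}" for t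
    proof -
      \<comment> \<open>The countably many exceptional null sets are united first, so that n can
        tend to infinity at a fixed x.\<close>
      have "AE x in lebesgue. \<forall>n. norm (u t x) \<le> exp (\<mu> * t) * (2 * C0 * ?w x + B / 2 ^ n)"
        using iter[OF t] by (simp add: AE_all_countable)
      then show ?thesis
      proof eventually_elim
        case (elim x)
        have "(\<lambda>n. exp (\<mu> * t) * (2 * C0 * ?w x + B * (1 / 2) ^ n)) \<longlonglongrightarrow> exp (\<mu> * t) * (2 * C0 * ?w x + B * 0)"
          by (intro tendsto_intros LIMSEQ_abs_realpow_zero2) auto
        then have "norm (u t x) \<le> exp (\<mu> * t) * (2 * C0 * ?w x + B * 0)"
          by (rule LIMSEQ_le_const) (use elim in \<open>auto simp: power_one_over\<close>)
        also have "\<dots> \<le> exp (\<mu> * S) * (2 * C0 * ?w x)"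
          using \<mu> t C0 by (simp add: mult_right_mono)
        finally show ?case by (simp add: M_def)
      qed
    qed
    have M: "M \<ge> 0" using C0 by (simp add: M_def)
    have K: "K > 0"
    proof -
      have "0 < K * (1 + norm (0::real^'n)) powr (?N - \<theta>)" using m[of 0] by linarith
      then show ?thesis by simp
    qed
    \<comment> \<open>The upper bound on m, inverted: up to the factor K, decay at rate
      \<open>?N\<close> is at least as good as the target weight.\<close>
    have N_le: "(1 + norm x) powr (- ?N) \<le> K * (?w x * inverse (m x))" for x :: "real^'n"
    proof -
      have "inverse ((1 + norm x) powr (?N - \<theta>)) \<le> K * inverse (m x)"
      proof -
        have "1 + norm x > 0" by (simp add: add_pos_nonneg)
        then have "0 < (1 + norm x) powr (?N - \<theta>)" by simp
        then show ?thesis using m[of x] by (simp add: field_simps)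
      qed
      then have "?w x * inverse ((1 + norm x) powr (?N - \<theta>)) \<le> ?w x * (K * inverse (m x))"
        by (intro mult_left_mono) auto
      moreover have "(1 + norm x) powr (- ?N) = ?w x * inverse ((1 + norm x) powr (?N - \<theta>))"
        unfolding powr_minus[symmetric] powr_add[symmetric] by simp
      ultimately show ?thesis by (simp only: mult.left_commute)
    qed
    show "\<exists>C'. \<forall>t\<in>{0..S}. AE x in lebesgue. norm (u t x) \<le> C' * ?w x * inverse (m x)"
    proof (intro exI ballI)
      fix t assume t: "t \<in> {0..S}"
      show "AE x in lebesgue. norm (u t x) \<le> (C0 + c * exp S * M\<^sup>2 * K) * ?w x * inverse (m x)"
        using mild[OF t]
      proof eventually_elim
        case (elim x)
        \<comment> \<open>With the decay of u known, a single application with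
          \<open>\<mu> = 1\<close> and \<open>q = 0\<close> at the full rate \<open>?N\<close> is
          enough: the square of \<open>?w\<close> decays at rate \<open>2 * \<theta>\<close>, which
          exceeds \<open>?N\<close>.\<close>
        have "norm (?D t x) \<le> c / 1 powr (1 / 4) * exp (1 * t) * (M\<^sup>2 * (1 + norm x) powr (- ?N) + 0)"
        proof (rule duhamel)
          fix s assume "s \<in> {0..<t}"
          then have s: "s \<in> {0..S}" "0 \<le> s" using t by auto
          show "AE y in lebesgue. (norm (u s y))\<^sup>2 \<le> exp (1 * s) * (M\<^sup>2 * (1 + norm y) powr (- ?N) + 0)"
            using decay[OF s(1)]
          proof eventually_elim
            case (elim y)
            have "(norm (u s y))\<^sup>2 \<le> (M * ?w y)\<^sup>2" using elim by (intro power_mono) auto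
            also have "\<dots> = M\<^sup>2 * (1 + norm y) powr (- \<theta> + - \<theta>)"
              by (simp only: power2_eq_square powr_add mult_ac)
            also have "\<dots> \<le> M\<^sup>2 * (1 + norm y) powr (- ?N)"
              using assms(7) by (intro mult_left_mono powr_mono) (auto simp: field_simps)
            also have "\<dots> = 1 * (M\<^sup>2 * (1 + norm y) powr (- ?N))" by simp
            also have "\<dots> \<le> exp (1 * s) * (M\<^sup>2 * (1 + norm y) powr (- ?N))"
              using s by (intro mult_right_mono) auto
            finally show ?case by simp
          qed
        qed (use t in auto)
        also have "\<dots> = c * exp t * M\<^sup>2 * (1 + norm x) powr (- ?N)" by simp
        also have "\<dots> \<le> c * exp S * M\<^sup>2 * (K * (?w x * inverse (m x)))"
          using c t by (intro mult_mono N_le) auto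
        finally have D: "norm (?D t x) \<le> c * exp S * M\<^sup>2 * (K * (?w x * inverse (m x)))" .
        have "norm (u t x) \<le> norm (heat t a x) + norm (?D t x)"
          unfolding elim by (rule norm_triangle_ineq4)
        also have "\<dots> \<le> C0 * ?w x * inverse (m x) + c * exp S * M\<^sup>2 * (K * (?w x * inverse (m x)))"
          by (intro add_mono heat t D)
        finally show ?case by (simp add: algebra_simps)
      qed
    qed
  qed
qed

end
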